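(* Let $A\in\mathbb{C}^{n\times n}$ be Hermitian, and let $\mathcal{X},\mathcal{Y}\subseteq\mathbb{C}^n$ be subspaces of the same dimension $k$, with orthonormal bases given by the columns of $X,Y\in\mathbb{C}^{n\times k}$ respectively, and suppose $\mathcal{X}$ or $\mathcal{Y}$ is $A$-invariant. Then $$|\lambda(X^HAX)-\lambda(Y^HAY)|\ \prec_w\ \mathrm{spr}(A)\Big[e-\cos\theta(\mathcal{X},\mathcal{Y})+\tfrac12\sin^2\theta(\mathcal{X},\mathcal{Y})\Big],$$ where $e=(1,\dots,1)^T\in\mathbb{R}^k$.
   Context: For a Hermitian matrix $M$, $\lambda(M)$ denotes the vector of its eigenvalues arranged in nonincreasing order, $\lambda_i(M)$ its $i$-th entry; for $A\in\mathbb{C}^{n\times n}$ Hermitian, $\mathrm{spr}(A)=\lambda_1(A)-\lambda_n(A)$. For any matrix $B$, $s(B)$ is the vector of singular values in nonincreasing order, and $s^{\uparrow}(B)$ the same in nondecreasing order. For subspaces $\mathcal{X},\mathcal{Y}$ of equal dimension $k$ with orthonormal-column basis matrices $X,Y$, the vector of principal angles $\theta(\mathcal{X},\mathcal{Y})\in[0,\pi/2]^k$ is arranged in nonincreasing order and defined by $\cos\theta(\mathcal{X},\mathcal{Y})=s^{\uparrow}(X^HY)$. Functions such as $\sin^2$, $\cos$, $|\cdot|$ act componentwise on vectors. For $x\in\mathbb{R}^k$, $x^{\downarrow}$ is $x$ rearranged in nonincreasing order; $x\prec_w y$ (weak submajorization) means $\sum_{i=1}^j x_i^{\downarrow}\le\sum_{i=1}^j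 y_i^{\downarrow}$ for all $1\le j\le k$. *)

theory Defs
  imports "Jordan_Normal_Form.Schur_Decomposition"
begin

definition hermitian_mat :: "complex mat \<Rightarrow> bool" where
  "hermitian_mat M \<longleftrightarrow> square_mat M \<and> mat_adjoint M = M"

definition eigvals :: "complex mat \<Rightarrow> real list" where
  "eigvals M = (THE l. length l = dim_row M \<and> sorted_wrt (\<ge>) l \<and>
      char_poly M = prod_list (map (\<lambda>x. [:- complex_of_real x, 1:]) l))"

definition spr :: "complex mat \<Rightarrow> real" where
  "spr M = hd (eigvals M) - last (eigvals M)"

(* singular values s(B) in nonincreasing order: square roots of the
   eigenvalues of B^H B (used here only for square B) *)
definition sing_vals :: "complex mat \<Rightarrow> real list" where
  "sing_vals B = map sqrt (eigvals (mat_adjoint B * B))"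

definition sing_vals_up :: "complex mat \<Rightarrow> real list" where
  "sing_vals_up B = rev (sing_vals B)"

definition orthonormal_cols :: "complex mat \<Rightarrow> bool" where
  "orthonormal_cols X \<longleftrightarrow> mat_adjoint X * X = 1\<^sub>m (dim_col X)"

definition col_space :: "complex mat \<Rightarrow> complex vec set" where
  "col_space X = {X *\<^sub>v c | c. c \<in> carrier_vec (dim_col X)}"

definition invariant_subspace :: "complex mat \<Rightarrow> complex vec set \<Rightarrow> bool" where
  "invariant_subspace A S \<longleftrightarrow> (\<forall>v\<in>S. A *\<^sub>v v \<in> S)"

definition principal_angles :: "complex mat \<Rightarrow> complex mat \<Rightarrow> real list" where
  "principal_angles X Y = map arccos (sing_vals_up (mat_adjoint X * Y))"

definition sort_desc :: "real list \<Rightarrow> real list" where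
  "sort_desc x = rev (sort x)"

definition weak_submaj :: "real list \<Rightarrow> real list \<Rightarrow> bool" where
  "weak_submaj x y \<longleftrightarrow> length x = length y \<and>
     (\<forall>j\<in>{1..length x}. sum_list (take j (sort_desc x)) \<le> sum_list (take j (sort_desc y)))"

end

theory Submission
  imports Defs "Jordan_Normal_Form.Spectral_Radius"
begin

text \<open>
  Assume that the column space of \<open>X\<close> is invariant (the other case follows by symmetry). A singular
  value decomposition of \<open>X\<^sup>H Y\<close> lets us assume \<open>X\<^sup>H Y = C = diag(cos \<theta>)\<close>, so that \<open>Y = X C + Z\<close> with
  \<open>X\<^sup>H Z = 0\<close> and \<open>Z\<^sup>H Z = 1 - C\<^sup>2\<close>. Write \<open>A = m + r B\<close> with \<open>r = spr A / 2\<close> and a Hermitian contraction \<open>B\<close>,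
  and \<open>B\<^sub>1 = X\<^sup>H B X\<close>. By invariance the cross terms vanish, hence
  \<open>X\<^sup>H A X - Y\<^sup>H A Y = r (B\<^sub>1 - C B\<^sub>1 C - Z\<^sup>H B Z)\<close>, where \<open>B\<^sub>1 - C B\<^sub>1 C = E K + K\<^sup>H E\<close> for
  \<open>E = 1 - C\<close> and the contraction \<open>K = B\<^sub>1 (1 + C) / 2\<close>. Mirsky's inequality reduces the claim to
  estimating the sum of \<open>|v\<^sup>H D v|\<close> over orthonormal eigenvectors \<open>v\<close> of this difference \<open>D\<close>; the two parts
  of \<open>D\<close> contribute at most the largest values of \<open>2 r (1 - cos \<theta>)\<close> and of \<open>r sin\<^sup>2 \<theta>\<close>.
\<close>

subsection \<open>Adjoints, quadratic forms and isometries\<close>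

text \<open>Majorization needs the \<open>j\<close> largest angles, not \<open>j\<close> times the
  largest one, so a bare norm bound on \<open>B\<^sub>1 - C B\<^sub>1 C\<close> is too weak. The
  form \<open>E K + K\<^sup>H E\<close> repairs this: at \<open>v\<close> its value is twice the
  real part of the sum of \<open>(1 - c\<^sub>p) cnj(v\<^sub>p) (K v)\<^sub>p\<close>, and
  \<open>2 a b <= a^2 + b^2\<close> makes the bound linear in two weight families,
  \<open>|v\<^sub>p|^2\<close> and \<open>|(K v)\<^sub>p|^2\<close>. Summed over \<open>j\<close>
  orthonormal vectors, each family is at most 1 at every \<open>p\<close> and at most
  \<open>j\<close> in total, so it picks up at most the \<open>j\<close> largest values of
  \<open>1 - c\<^sub>p\<close>. Two families turn the factor \<open>r = spr A / 2\<close> into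
  \<open>spr A\<close>; the sine term carries \<open>|v\<^sub>p|^2\<close> alone and keeps the 1/2.
  Both \<open>1 - c\<close> and \<open>1 - c^2\<close> decrease in \<open>c\<close> on [0, 1], so
  their largest values sit at the same indices and the separate bounds add up to a partial sum of
  the right-hand side. Subtracting the midpoint \<open>m\<close> is free, as it shifts both
  compressions equally, and it brings the norm down to \<open>spr A / 2\<close>.\<close>

definition norm_sq :: "complex vec \<Rightarrow> real" where
  "norm_sq v = (\<Sum>i<dim_vec v. (cmod (v $ i))\<^sup>2)"

text \<open>The numerator of the Rayleigh quotient. It is already real for Hermitian
  \<open>M\<close>; taking \<open>Re\<close> gives a real-valued function without a side
  condition.\<close>

definition quad_form :: "complex mat \<Rightarrow> complex vec \<Rightarrow> real" where
  "quad_form M v = Re ((M *\<^sub>v v) \<bullet>c v)"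

lemma mat_adjoint_carrier[simp]:
  "M \<in> carrier_mat n m \<Longrightarrow> mat_adjoint (M :: complex mat) \<in> carrier_mat m n"
  by (auto simp: mat_adjoint_def)

lemma mat_adjoint_dim[simp]:
  "dim_row (mat_adjoint (M :: complex mat)) = dim_col M"
  "dim_col (mat_adjoint (M :: complex mat)) = dim_row M"
  by (auto simp: mat_adjoint_def)

lemma mat_adjoint_index[simp]:
  assumes "i < dim_col M" "j < dim_row M"
  shows "mat_adjoint (M :: complex mat) $$ (i, j) = cnj (M $$ (j, i))"
  using assms by (auto simp: mat_adjoint_def mat_of_rows_def conjugate_vec_def)

lemma mat_adjoint_adjoint[simp]: "mat_adjoint (mat_adjoint M) = (M :: complex mat)"
  by (rule eq_matI) auto

lemma mult_mat_index_sum: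
  assumes "P \<in> carrier_mat n m" "Q \<in> carrier_mat m p" "i < n" "j < p"
  shows "(P * Q) $$ (i, j) = (\<Sum>k<m. P $$ (i, k) * Q $$ (k, j))"
  using assms by (auto simp: scalar_prod_def atLeast0LessThan)

lemma mult_mat_vec_index_sum:
  assumes "P \<in> carrier_mat n m" "v \<in> carrier_vec m" "i < n"
  shows "(P *\<^sub>v v) $ i = (\<Sum>k<m. P $$ (i, k) * v $ k)"
  using assms by (auto simp: scalar_prod_def atLeast0LessThan)

lemma cscalar_prod_sum:
  assumes "w \<in> carrier_vec n"
  shows "(v :: complex vec) \<bullet>c w = (\<Sum>i<n. v $ i * cnj (w $ i))"
  using assms by (auto simp: scalar_prod_def atLeast0LessThan intro!: sum.cong)

lemma norm_sq_sum: "v \<in> carrier_vec n \<Longrightarrow> norm_sq v = (\<Sum>i<n. (cmod (v $ i))\<^sup>2)"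
  by (auto simp: norm_sq_def)

lemma norm_sq_cscalar: "complex_of_real (norm_sq v) = v \<bullet>c v"
  by (simp add: cscalar_prod_sum[of v "dim_vec v"] norm_sq_def flip: complex_norm_square)

lemma norm_sq_nonneg[simp]: "0 \<le> norm_sq v"
  by (auto simp: norm_sq_def intro: sum_nonneg)

lemma norm_sq_pos:
  assumes "v \<in> carrier_vec n" "v \<noteq> 0\<^sub>v n"
  shows "0 < norm_sq v"
proof -
  obtain i where "i < n" "v $ i \<noteq> 0" using assms by (metis carrier_vecD eq_vecI index_zero_vec)
  then have "0 < (\<Sum>i<n. (cmod (v $ i))\<^sup>2)" by (intro sum_pos2[of _ i]) auto
  then show ?thesis using assms by (simp add: norm_sq_sum)
qed

lemma mat_adjoint_mult:
  assumes "P \<in> carrier_mat n m" "Q \<in> carrier_mat m p"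
  shows "mat_adjoint (P * Q) = mat_adjoint Q * mat_adjoint (P :: complex mat)"
proof (rule eq_matI)
  fix i j assume *: "i < dim_row (mat_adjoint Q * mat_adjoint P)"
    "j < dim_col (mat_adjoint Q * mat_adjoint P)"
  with assms have ij: "i < p" "j < n" by auto
  with assms * show "mat_adjoint (P * Q) $$ (i, j) = (mat_adjoint Q * mat_adjoint P) $$ (i, j)"
    by (subst mat_adjoint_index, simp, simp, subst mult_mat_index_sum[OF assms], simp, simp,
        subst mult_mat_index_sum[of _ p m _ n]) (auto intro!: sum.cong)
qed (use assms in auto)

lemma mat_adjoint_one[simp]: "mat_adjoint (1\<^sub>m n) = (1\<^sub>m n :: complex mat)"
  by (rule eq_matI) auto

lemma mat_diag_index[simp]:
  "i < n \<Longrightarrow> j < n \<Longrightarrow> mat_diag n f $$ (i, j) = (if i = j then f j else 0)"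
  by (auto simp: mat_diag_def)

lemma mat_diag_dims[simp]: "dim_row (mat_diag n f) = n" "dim_col (mat_diag n f) = n"
  by (auto simp: mat_diag_def)

lemma mat_adjoint_diag_of_real[simp]:
  "mat_adjoint (mat_diag n (\<lambda>i. complex_of_real (f i))) = mat_diag n (\<lambda>i. complex_of_real (f i))"
  by (rule eq_matI) auto

lemma adjoint_mult_index:
  assumes "V \<in> carrier_mat n m" "W \<in> carrier_mat n p" "i < m" "j < p"
  shows "(mat_adjoint V * W) $$ (i, j) = (\<Sum>k<n. cnj (V $$ (k, i)) * W $$ (k, j))"
  using assms by (subst mult_mat_index_sum[of _ m n _ p]) auto

lemma cscalar_prod_adjoint:
  fixes M :: "complex mat"
  assumes M: "M \<in> carrier_mat n m" and v: "v \<in> carrier_vec m" and w: "w \<in> carrier_vec n"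
  shows "(M *\<^sub>v v) \<bullet>c w = v \<bullet>c (mat_adjoint M *\<^sub>v w)"
proof -
  have a: "mat_adjoint M *\<^sub>v w \<in> carrier_vec m" using M w by (intro mult_mat_vec_carrier[of _ m n]) simp_all
  have "(M *\<^sub>v v) \<bullet>c w = (\<Sum>i<n. \<Sum>k<m. M $$ (i, k) * v $ k * cnj (w $ i))"
    using M v w
    by (auto simp: cscalar_prod_sum[of w n] mult_mat_vec_index_sum[of M n m] sum_distrib_right
        simp del: index_mult_mat_vec intro!: sum.cong)
  also have "\<dots> = (\<Sum>k<m. \<Sum>i<n. M $$ (i, k) * v $ k * cnj (w $ i))" by (rule sum.swap)
  also have "\<dots> = v \<bullet>c (mat_adjoint M *\<^sub>v w)"
    using M v w a
    by (auto simp: cscalar_prod_sum[of _ m] mult_mat_vec_index_sum[of "mat_adjoint M" m n] sum_distrib_left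
        simp del: index_mult_mat_vec intro!: sum.cong)
  finally show ?thesis .
qed

lemma norm_sq_isometry:
  assumes V: "V \<in> carrier_mat n m" and iso: "mat_adjoint V * V = 1\<^sub>m m" and v: "v \<in> carrier_vec m"
  shows "norm_sq (V *\<^sub>v v) = norm_sq v"
proof -
  have "(V *\<^sub>v v) \<bullet>c (V *\<^sub>v v) = v \<bullet>c (mat_adjoint V *\<^sub>v (V *\<^sub>v v))"
    using V v by (intro cscalar_prod_adjoint) auto
  also have "mat_adjoint V *\<^sub>v (V *\<^sub>v v) = v"
    using V v iso by (subst assoc_mult_mat_vec[symmetric, of _ m n _ m]) auto
  finally show ?thesis by (metis norm_sq_cscalar of_real_eq_iff)
qed

section \<open>Dimension counts, completion to a unitary matrix, eigenvectors in a
  complement\<close>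

lemma exists_kernel_vec:
  fixes M :: "complex mat"
  assumes M: "M \<in> carrier_mat m n" and "m < n"
  shows "\<exists>v \<in> carrier_vec n. v \<noteq> 0\<^sub>v n \<and> M *\<^sub>v v = 0\<^sub>v m"
proof -
  \<comment> \<open>Padding with zero rows makes the matrix square and singular and keeps its first
    \<open>m\<close> rows. Row \<open>m\<close> is singled out because \<open>det_row_0\<close> asks
    for one designated zero row.\<close>
  define N where "N = mat\<^sub>r n n (\<lambda>i. if i = m then 0\<^sub>v n else if i < m then row M i else 0\<^sub>v n)"
  have N: "N \<in> carrier_mat n n" by (simp add: N_def)
  have "det N = 0" unfolding N_def using M \<open>m < n\<close> by (intro det_row_0) auto
  then obtain v where v: "v \<in> carrier_vec n" "v \<noteq> 0\<^sub>v n" "N *\<^sub>v v = 0\<^sub>v n"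
    using det_0_iff_vec_prod_zero[OF N] by auto
  have "M *\<^sub>v v = 0\<^sub>v m"
  proof (rule eq_vecI)
    fix i assume "i < dim_vec (0\<^sub>v m :: complex vec)"
    then have i: "i < m" by simp
    have "row M i = row N i" using i \<open>m < n\<close> M by (intro eq_vecI) (auto simp: N_def)
    then have "(M *\<^sub>v v) $ i = (N *\<^sub>v v) $ i" using i \<open>m < n\<close> M N by auto
    then show "(M *\<^sub>v v) $ i = 0\<^sub>v m $ i" using v(3) i \<open>m < n\<close> by simp
  qed (use M in auto)
  then show ?thesis using v by blast
qed

lemma norm_sq_smult: "norm_sq (a \<cdot>\<^sub>v v) = (cmod a)\<^sup>2 * norm_sq v"
  by (simp add: norm_sq_def norm_mult power_mult_distrib sum_distrib_left)

lemma norm_sq_normalize: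
  assumes "v \<in> carrier_vec n" "v \<noteq> 0\<^sub>v n"
  shows "norm_sq (complex_of_real (1 / sqrt (norm_sq v)) \<cdot>\<^sub>v v) = 1"
proof -
  have "norm_sq v > 0" using norm_sq_pos[OF assms] .
  then show ?thesis unfolding norm_sq_smult norm_of_real
    by (simp add: power_divide)
qed

lemma isometry_index:
  assumes "V \<in> carrier_mat n m"
  shows "mat_adjoint V * V = 1\<^sub>m m \<longleftrightarrow>
    (\<forall>i<m. \<forall>j<m. (\<Sum>k<n. cnj (V $$ (k, i)) * V $$ (k, j)) = (if i = j then 1 else 0))"
  (is "?l \<longleftrightarrow> ?r")
proof
  assume l: ?l
  show ?r
  proof (intro allI impI)
    fix i j assume ij: "i < m" "j < m"
    have "(mat_adjoint V * V) $$ (i, j) = (\<Sum>k<n. cnj (V $$ (k, i)) * V $$ (k, j))"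
      by (rule adjoint_mult_index[OF assms assms ij])
    then show "(\<Sum>k<n. cnj (V $$ (k, i)) * V $$ (k, j)) = (if i = j then 1 else 0)"
      using l ij by simp
  qed
next
  assume r: ?r
  show ?l
    by (rule eq_matI) (use assms r in \<open>auto simp: adjoint_mult_index[OF assms assms] simp del: index_mult_mat(1)\<close>)
qed

lemma exists_unit_orthogonal:
  assumes V: "V \<in> carrier_mat n m" and "m < n"
  shows "\<exists>v \<in> carrier_vec n. norm_sq v = 1 \<and> mat_adjoint V *\<^sub>v v = 0\<^sub>v m"
proof -
  obtain v where v: "v \<in> carrier_vec n" "v \<noteq> 0\<^sub>v n" "mat_adjoint V *\<^sub>v v = 0\<^sub>v m"
    using exists_kernel_vec[OF mat_adjoint_carrier[OF V] \<open>m < n\<close>] by blast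
  let ?w = "complex_of_real (1 / sqrt (norm_sq v)) \<cdot>\<^sub>v v"
  have "mat_adjoint V *\<^sub>v ?w = 0\<^sub>v m"
    using mult_mat_vec[OF mat_adjoint_carrier[OF V] v(1)] v(3) by (simp, intro eq_vecI) auto
  then show ?thesis using norm_sq_normalize[OF v(1,2)] v(1) by (intro bexI[of _ ?w]) auto
qed

definition append_col :: "complex mat \<Rightarrow> complex vec \<Rightarrow> complex mat" where
  "append_col V v = Matrix.mat (dim_row V) (Suc (dim_col V))
     (\<lambda>(i, j). if j < dim_col V then V $$ (i, j) else v $ i)"

lemma append_col_carrier[simp]:
  "V \<in> carrier_mat n m \<Longrightarrow> append_col V v \<in> carrier_mat n (Suc m)"
  by (auto simp: append_col_def)

lemma append_col_index:
  assumes "V \<in> carrier_mat n m" "i < n" "j < Suc m"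
  shows "append_col V v $$ (i, j) = (if j < m then V $$ (i, j) else v $ i)"
  using assms by (auto simp: append_col_def)

lemma isometry_append_col:
  assumes V: "V \<in> carrier_mat n m" and iso: "mat_adjoint V * V = 1\<^sub>m m"
    and v: "v \<in> carrier_vec n" "norm_sq v = 1" "mat_adjoint V *\<^sub>v v = 0\<^sub>v m"
  shows "mat_adjoint (append_col V v) * append_col V v = 1\<^sub>m (Suc m)"
proof -
  have vv: "(\<Sum>k<n. cnj (v $ k) * v $ k) = 1"
    using norm_sq_cscalar[of v] v by (simp add: cscalar_prod_sum[of v n] mult.commute)
  have Vv: "(\<Sum>k<n. cnj (V $$ (k, i)) * v $ k) = 0" if "i < m" for i
  proof -
    have "(mat_adjoint V *\<^sub>v v) $ i = (\<Sum>k<n. mat_adjoint V $$ (i, k) * v $ k)"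
      by (rule mult_mat_vec_index_sum[OF mat_adjoint_carrier[OF V] v(1) that])
    also have "\<dots> = (\<Sum>k<n. cnj (V $$ (k, i)) * v $ k)"
      using V that by (intro sum.cong) auto
    finally show ?thesis using v(3) that by simp
  qed
  have vV: "(\<Sum>k<n. cnj (v $ k) * V $$ (k, i)) = 0" if "i < m" for i
    using arg_cong[OF Vv[OF that], of cnj] by (simp add: mult.commute)
  show ?thesis unfolding isometry_index[OF append_col_carrier[OF V]]
  proof (intro allI impI)
    fix i j assume ij: "i < Suc m" "j < Suc m"
    have "(\<Sum>k<n. cnj (append_col V v $$ (k, i)) * append_col V v $$ (k, j)) =
      (\<Sum>k<n. cnj (if i < m then V $$ (k, i) else v $ k) * (if j < m then V $$ (k, j) else v $ k))"
      using ij by (intro sum.cong) (auto simp: append_col_index[OF V])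
    also have "\<dots> = (if i = j then 1 else 0)"
      using ij vv Vv vV iso[unfolded isometry_index[OF V]]
      by (cases "i < m"; cases "j < m") (auto simp: less_Suc_eq)
    finally show "(\<Sum>k<n. cnj (append_col V v $$ (k, i)) * append_col V v $$ (k, j)) = (if i = j then 1 else 0)" .
  qed
qed

text \<open>Columns are added one at a time from the kernel of the adjoint, which is nonzero as long
  as \<open>m < n\<close>. Since the old entries are kept, the last \<open>n - m\<close> columns
  span the orthogonal complement of the first \<open>m\<close>.\<close>

lemma isometry_completion:
  assumes "V \<in> carrier_mat n m" "mat_adjoint V * V = 1\<^sub>m m" "m \<le> n"
  shows "\<exists>U \<in> carrier_mat n n. mat_adjoint U * U = (1\<^sub>m n :: complex mat) \<and> (\<forall>i<n. \<forall>j<m. U $$ (i, j) = V $$ (i, j))"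
  using assms
proof (induction "n - m" arbitrary: m V)
  case 0
  then show ?case by (intro bexI[of _ V]) auto
next
  case (Suc d)
  then have "m < n" by auto
  obtain v where v: "v \<in> carrier_vec n" "norm_sq v = 1" "mat_adjoint V *\<^sub>v v = 0\<^sub>v m"
    using exists_unit_orthogonal[OF Suc.prems(1) \<open>m < n\<close>] by blast
  have "\<exists>U \<in> carrier_mat n n. mat_adjoint U * U = 1\<^sub>m n \<and>
      (\<forall>i<n. \<forall>j<Suc m. U $$ (i, j) = append_col V v $$ (i, j))"
    using Suc.hyps(2) \<open>m < n\<close>
    by (intro Suc.hyps(1) isometry_append_col[OF Suc.prems(1,2) v] append_col_carrier[OF Suc.prems(1)]) auto
  then show ?case using append_col_index[OF Suc.prems(1)] by (metis less_SucI)
qed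

lemma unitary_right:
  assumes "(U :: complex mat) \<in> carrier_mat n n" "mat_adjoint U * U = 1\<^sub>m n"
  shows "U * mat_adjoint U = 1\<^sub>m n"
  using mat_mult_left_right_inverse[OF mat_adjoint_carrier[OF assms(1)] assms] .

lemma exists_eigenvector:
  assumes "(M :: complex mat) \<in> carrier_mat n n" "0 < n"
  shows "\<exists>v e. v \<in> carrier_vec n \<and> v \<noteq> 0\<^sub>v n \<and> M *\<^sub>v v = e \<cdot>\<^sub>v v"
proof -
  obtain e where "e \<in> spectrum M" using spectrum_non_empty[OF assms] by auto
  then have "eigenvalue M e" by (simp add: spectrum_def)
  then show ?thesis using assms unfolding eigenvalue_def eigenvector_def by auto
qed

text \<open>Deflation. As \<open>A\<close> is Hermitian, the orthogonal complement of the invariant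
  column space of \<open>V\<close> is invariant as well. Compressing \<open>A\<close> to an
  orthonormal basis \<open>W\<close> of this complement gives a smaller matrix \<open>C\<close>, and
  an eigenvector of \<open>C\<close> lifts through \<open>W\<close> to one of
  \<open>A\<close>.\<close>

lemma exists_orthogonal_eigenvector:
  assumes A: "A \<in> carrier_mat n n" "mat_adjoint A = A"
    and V: "V \<in> carrier_mat n m" "mat_adjoint V * V = 1\<^sub>m m" "A * V = V * mat_diag m l"
    and "m < n"
  shows "\<exists>v e. v \<in> carrier_vec n \<and> norm_sq v = 1 \<and> mat_adjoint V *\<^sub>v v = 0\<^sub>v m \<and> A *\<^sub>v v = e \<cdot>\<^sub>v v"
proof -
  obtain U where U: "U \<in> carrier_mat n n" "mat_adjoint U * U = 1\<^sub>m n"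
    and UV: "\<forall>i<n. \<forall>j<m. U $$ (i, j) = V $$ (i, j)"
    using isometry_completion[OF V(1,2)] \<open>m < n\<close> by auto
  define W where "W = Matrix.mat n (n - m) (\<lambda>(i, j). U $$ (i, m + j))"
  have W: "W \<in> carrier_mat n (n - m)" by (simp add: W_def)
  note Uo = U(2)[unfolded isometry_index[OF U(1)], rule_format]
  have WW: "mat_adjoint W * W = 1\<^sub>m (n - m)"
    unfolding isometry_index[OF W]
  proof (intro allI impI)
    fix i j assume ij: "i < n - m" "j < n - m"
    have "(\<Sum>k<n. cnj (W $$ (k, i)) * W $$ (k, j)) = (\<Sum>k<n. cnj (U $$ (k, m + i)) * U $$ (k, m + j))"
      using ij by (intro sum.cong) (auto simp: W_def)
    then show "(\<Sum>k<n. cnj (W $$ (k, i)) * W $$ (k, j)) = (if i = j then 1 else 0)"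
      using Uo[of "m + i" "m + j"] ij by simp
  qed
  have VW: "mat_adjoint V * W = 0\<^sub>m m (n - m)"
  proof (rule eq_matI)
    fix i j assume "i < dim_row (0\<^sub>m m (n - m) :: complex mat)" "j < dim_col (0\<^sub>m m (n - m) :: complex mat)"
    then have ij: "i < m" "j < n - m" by auto
    have "(mat_adjoint V * W) $$ (i, j) = (\<Sum>k<n. cnj (V $$ (k, i)) * W $$ (k, j))"
      by (rule adjoint_mult_index[OF V(1) W ij])
    also have "\<dots> = (\<Sum>k<n. cnj (U $$ (k, i)) * U $$ (k, m + j))"
      using ij UV by (intro sum.cong) (auto simp: W_def)
    also have "\<dots> = 0" using Uo[of i "m + j"] ij by simp
    finally show "(mat_adjoint V * W) $$ (i, j) = 0\<^sub>m m (n - m) $$ (i, j)" using ij by simp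
  qed (use V W in auto)
  \<comment> \<open>\<open>W W\<^sup>H\<close> is the identity on the complement: of the coordinates
    \<open>mat_adjoint U *\<^sub>v x\<close> the first \<open>m\<close> vanish, and the others are
    those of \<open>mat_adjoint W *\<^sub>v x\<close>.\<close>
  have res: "x = W *\<^sub>v (mat_adjoint W *\<^sub>v x)"
    if x: "x \<in> carrier_vec n" and Vx: "mat_adjoint V *\<^sub>v x = 0\<^sub>v m" for x
  proof -
    let ?y = "mat_adjoint U *\<^sub>v x"
    have y: "?y \<in> carrier_vec n" using U x by (intro mult_mat_vec_carrier[of _ n n]) auto
    have Wx: "mat_adjoint W *\<^sub>v x \<in> carrier_vec (n - m)"
      using W x by (intro mult_mat_vec_carrier[of _ _ n]) auto
    have y0: "?y $ i = 0" if "i < m" for i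
    proof -
      have "?y $ i = (mat_adjoint V *\<^sub>v x) $ i"
        using U V UV x that \<open>m < n\<close>
        by (subst mult_mat_vec_index_sum[of _ n n], simp, simp, simp,
            subst mult_mat_vec_index_sum[of _ m n]) (auto intro!: sum.cong)
      then show ?thesis using Vx that by simp
    qed
    have y1: "?y $ (m + i) = (mat_adjoint W *\<^sub>v x) $ i" if "i < n - m" for i
      using U W x that \<open>m < n\<close>
        by (subst mult_mat_vec_index_sum[of _ n n], simp, simp, simp,
            subst mult_mat_vec_index_sum[of _ "n - m" n]) (auto intro!: sum.cong simp: W_def)
    have "x = U *\<^sub>v ?y"
      using U x unitary_right[OF U] by (subst assoc_mult_mat_vec[symmetric, of _ n n _ n]) auto
    also have "\<dots> = W *\<^sub>v (mat_adjoint W *\<^sub>v x)"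
    proof (rule eq_vecI)
      fix i assume "i < dim_vec (W *\<^sub>v (mat_adjoint W *\<^sub>v x))"
      then have i: "i < n" using W by simp
      have "(U *\<^sub>v ?y) $ i = (\<Sum>k<n. U $$ (i, k) * ?y $ k)"
        by (rule mult_mat_vec_index_sum[OF U(1) y i])
      also have "\<dots> = (\<Sum>k\<in>{m..<n}. U $$ (i, k) * ?y $ k)"
        using y0 by (intro sum.mono_neutral_right) auto
      also have "\<dots> = (\<Sum>k<n - m. U $$ (i, m + k) * ?y $ (m + k))"
        using \<open>m < n\<close> by (intro sum.reindex_bij_witness[of _ "\<lambda>k. m + k" "\<lambda>k. k - m"]) auto
      also have "\<dots> = (\<Sum>k<n - m. W $$ (i, k) * (mat_adjoint W *\<^sub>v x) $ k)"
        using y1 i by (intro sum.cong) (auto simp: W_def)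
      also have "\<dots> = (W *\<^sub>v (mat_adjoint W *\<^sub>v x)) $ i"
        by (rule mult_mat_vec_index_sum[OF W Wx i, symmetric])
      finally show "(U *\<^sub>v ?y) $ i = (W *\<^sub>v (mat_adjoint W *\<^sub>v x)) $ i" .
    qed (use U W in auto)
    finally show ?thesis .
  qed
  define C where "C = mat_adjoint W * (A * W)"
  have C: "C \<in> carrier_mat (n - m) (n - m)" using W A by (auto simp: C_def)
  obtain c e where c: "c \<in> carrier_vec (n - m)" "c \<noteq> 0\<^sub>v (n - m)" "C *\<^sub>v c = e \<cdot>\<^sub>v c"
    using exists_eigenvector[OF C] \<open>m < n\<close> by auto
  define d where "d = complex_of_real (1 / sqrt (norm_sq c)) \<cdot>\<^sub>v c"
  have d: "d \<in> carrier_vec (n - m)" "norm_sq d = 1"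
    using c norm_sq_normalize[OF c(1,2)] by (auto simp: d_def)
  have Cd: "C *\<^sub>v d = e \<cdot>\<^sub>v d"
    using mult_mat_vec[OF C c(1)] c(3) by (simp add: d_def smult_smult_assoc mult.commute)
  define v where "v = W *\<^sub>v d"
  have v: "v \<in> carrier_vec n" using W d by (auto simp: v_def)
  have Av: "A *\<^sub>v v \<in> carrier_vec n" using A v by auto
  have Vv: "mat_adjoint V *\<^sub>v v = 0\<^sub>v m"
  proof -
    have "mat_adjoint V *\<^sub>v v = (mat_adjoint V * W) *\<^sub>v d"
      unfolding v_def by (rule assoc_mult_mat_vec[symmetric, OF mat_adjoint_carrier[OF V(1)] W d(1)])
    then show ?thesis using VW d by (simp, intro eq_vecI) (auto simp: scalar_prod_def)
  qed
  have VAv: "mat_adjoint V *\<^sub>v (A *\<^sub>v v) = 0\<^sub>v m"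
  proof -
    \<comment> \<open>Taking adjoints in \<open>A V = V diag(l)\<close> shows that \<open>A\<close>
      cannot leave the complement.\<close>
    have "mat_adjoint V * A = mat_adjoint (A * V)"
      using mat_adjoint_mult[OF A(1) V(1)] A by simp
    also have "\<dots> = mat_adjoint (mat_diag m l) * mat_adjoint V"
      using mat_adjoint_mult[OF V(1), of "mat_diag m l" m] V(3) by simp
    finally have eq: "mat_adjoint V * A = mat_adjoint (mat_diag m l) * mat_adjoint V" .
    have "mat_adjoint V *\<^sub>v (A *\<^sub>v v) = (mat_adjoint V * A) *\<^sub>v v"
      by (rule assoc_mult_mat_vec[symmetric, OF mat_adjoint_carrier[OF V(1)] A(1) v])
    also have "\<dots> = mat_adjoint (mat_diag m l) *\<^sub>v (mat_adjoint V *\<^sub>v v)"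
      unfolding eq by (rule assoc_mult_mat_vec[OF _ mat_adjoint_carrier[OF V(1)] v]) auto
    also have "\<dots> = 0\<^sub>v m" unfolding Vv by (rule eq_vecI) (auto simp: scalar_prod_def)
    finally show ?thesis .
  qed
  have "mat_adjoint W *\<^sub>v (A *\<^sub>v v) = C *\<^sub>v d"
    unfolding C_def v_def
    using assoc_mult_mat_vec[OF mat_adjoint_carrier[OF W] mult_carrier_mat[OF A(1) W] d(1)]
      assoc_mult_mat_vec[OF A(1) W d(1)] by simp
  then have "A *\<^sub>v v = W *\<^sub>v (e \<cdot>\<^sub>v d)" using res[OF Av VAv] Cd by simp
  also have "\<dots> = e \<cdot>\<^sub>v v" unfolding v_def by (rule mult_mat_vec[OF W d(1)])
  finally have "A *\<^sub>v v = e \<cdot>\<^sub>v v" .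
  moreover have "norm_sq v = 1" unfolding v_def using norm_sq_isometry[OF W WW d(1)] d(2) by simp
  ultimately show ?thesis using v Vv by blast
qed

subsection \<open>Spectral theorem and eigenvalue lists\<close>

text \<open>Partial systems of \<open>m\<close> eigenvectors make the induction possible. The
  eigenvalues are still complex here; their reality is extracted later from the complete
  diagonalization.\<close>

lemma exists_eigen_isometry:
  assumes A: "A \<in> carrier_mat n n" "mat_adjoint A = A" and "m \<le> n"
  shows "\<exists>V \<in> carrier_mat n m. \<exists>l. mat_adjoint V * V = 1\<^sub>m m \<and> A * V = V * mat_diag m (l :: nat \<Rightarrow> complex)"
  using \<open>m \<le> n\<close>
proof (induction m)
  case 0
  show ?case
    by (rule bexI[of _ "0\<^sub>m n 0"], rule exI[of _ undefined], intro conjI eq_matI) (use A in auto)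
next
  case (Suc m)
  then obtain V l where V: "V \<in> carrier_mat n m" "mat_adjoint V * V = 1\<^sub>m m" "A * V = V * mat_diag m l"
    by auto
  obtain v e where v: "v \<in> carrier_vec n" "norm_sq v = 1" "mat_adjoint V *\<^sub>v v = 0\<^sub>v m" and e: "A *\<^sub>v v = e \<cdot>\<^sub>v v"
    using exists_orthogonal_eigenvector[OF A V] Suc.prems by auto
  let ?V = "append_col V v" and ?l = "l(m := e)"
  have cV: "?V \<in> carrier_mat n (Suc m)" using V by simp
  have "A * ?V = ?V * mat_diag (Suc m) ?l"
  proof (rule eq_matI)
    fix i j assume "i < dim_row (?V * mat_diag (Suc m) ?l)" "j < dim_col (?V * mat_diag (Suc m) ?l)"
    then have ij: "i < n" "j < Suc m" using cV by auto
    have "(A * ?V) $$ (i, j) = (\<Sum>k<n. A $$ (i, k) * (if j < m then V $$ (k, j) else v $ k))"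
      by (subst mult_mat_index_sum[OF A(1) cV ij], intro sum.cong) (use ij in \<open>auto simp: append_col_index[OF V(1)]\<close>)
    also have "\<dots> = (if j < m then (A * V) $$ (i, j) else (A *\<^sub>v v) $ i)"
      using mult_mat_index_sum[OF A(1) V(1) ij(1), of j] mult_mat_vec_index_sum[OF A(1) v(1) ij(1)]
      by (cases "j < m") simp_all
    also have "\<dots> = ?V $$ (i, j) * ?l j"
      using ij v(1) V(1) by (auto simp: V(3) e mat_diag_mult_right[OF V(1)] append_col_index[OF V(1)] less_Suc_eq)
    also have "\<dots> = (?V * mat_diag (Suc m) ?l) $$ (i, j)"
      using ij by (simp add: mat_diag_mult_right[OF cV])
    finally show "(A * ?V) $$ (i, j) = (?V * mat_diag (Suc m) ?l) $$ (i, j)" .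
  qed (use A cV in auto)
  then show ?case using isometry_append_col[OF V(1,2) v] cV by blast
qed

text \<open>A permutation is produced, and not just a sorted list, so that the columns of an
  eigenvector matrix can be reordered together with the eigenvalues.\<close>

lemma exists_sorting_permutation:
  fixes l :: "nat \<Rightarrow> real"
  shows "\<exists>p. p permutes {..<n} \<and> (\<forall>i j. i \<le> j \<longrightarrow> j < n \<longrightarrow> l (p j) \<le> l (p i))"
proof -
  let ?xs = "map l [0..<n]" and ?ys = "rev (sort (map l [0..<n]))"
  have "mset ?ys = mset ?xs" by simp
  then obtain p where p: "p permutes {..<length ?xs}" "permute_list p ?xs = ?ys"
    by (rule mset_eq_permutation)
  have eq: "?ys ! i = l (p i)" if "i < n" for i
  proof -
    have "?ys ! i = ?xs ! p i" using permute_list_nth[OF p(1)] that p(2) by simp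
    moreover have "p i < n" using p(1) that by (simp add: permutes_in_image[of p "{..<n}" i, simplified])
    ultimately show ?thesis by simp
  qed
  have "sorted_wrt (\<ge>) ?ys" by (simp add: sorted_wrt_rev)
  then have "l (p j) \<le> l (p i)" if "i \<le> j" "j < n" for i j
    using eq[of i] eq[of j] that sorted_wrt_nth_less[of "(\<ge>)" ?ys i j] by (cases "i = j") auto
  then show ?thesis using p(1) by auto
qed

lemma hermitian_diagonalization:
  assumes A: "A \<in> carrier_mat n n" "mat_adjoint A = A"
  shows "\<exists>U \<in> carrier_mat n n. \<exists>l. mat_adjoint U * U = 1\<^sub>m n \<and>
    A = U * mat_diag n (\<lambda>i. complex_of_real (l i)) * mat_adjoint U \<and>
    (\<forall>i j. i \<le> j \<longrightarrow> j < n \<longrightarrow> l j \<le> l i)"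
proof -
  obtain V l where V: "V \<in> carrier_mat n n" "mat_adjoint V * V = 1\<^sub>m n" "A * V = V * mat_diag n (l :: nat \<Rightarrow> complex)"
    using exists_eigen_isometry[OF A order_refl] by auto
  obtain p where p: "p permutes {..<n}" and srt: "\<forall>i j. i \<le> j \<longrightarrow> j < n \<longrightarrow> Re (l (p j)) \<le> Re (l (p i))"
    using exists_sorting_permutation[of n "\<lambda>i. Re (l i)"] by auto
  have pn: "p i < n" if "i < n" for i
    using p that by (simp add: permutes_in_image[of p "{..<n}" i, simplified])
  have D: "mat_adjoint V * (A * V) = mat_diag n l"
    using V by (simp add: assoc_mult_mat[symmetric, of _ n n _ n _ n])
  \<comment> \<open>Reality of the eigenvalues: \<open>mat_diag n l\<close> equals the Hermitian
    matrix \<open>V\<^sup>H A V\<close>, so each \<open>l i\<close> is its own conjugate.\<close>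
  have "mat_adjoint (mat_adjoint V * (A * V)) = mat_adjoint V * (A * V)"
    using V A mat_adjoint_mult[OF mat_adjoint_carrier[OF V(1)] mult_carrier_mat[OF A(1) V(1)]]
      mat_adjoint_mult[OF A(1) V(1)] assoc_mult_mat[OF mat_adjoint_carrier[OF V(1)] A(1) V(1)] by simp
  then have "mat_adjoint (mat_diag n l) = mat_diag n l" unfolding D .
  then have "mat_adjoint (mat_diag n l) $$ (i, i) = mat_diag n l $$ (i, i)" for i by simp
  then have cnj: "cnj (l i) = l i" if "i < n" for i using that by (metis mat_adjoint_index mat_diag_dims mat_diag_index)
  then have re: "complex_of_real (Re (l i)) = l i" if "i < n" for i
    using that by (metis of_real_Re Reals_cnj_iff)
  define U where "U = Matrix.mat n n (\<lambda>(i, j). V $$ (i, p j))"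
  define d where "d = (\<lambda>i. Re (l (p i)))"
  have U: "U \<in> carrier_mat n n" by (simp add: U_def)
  have UU: "mat_adjoint U * U = 1\<^sub>m n"
    unfolding isometry_index[OF U]
  proof (intro allI impI)
    fix i j assume ij: "i < n" "j < n"
    have "(\<Sum>k<n. cnj (U $$ (k, i)) * U $$ (k, j)) = (\<Sum>k<n. cnj (V $$ (k, p i)) * V $$ (k, p j))"
      using ij by (intro sum.cong) (auto simp: U_def)
    also have "\<dots> = (if p i = p j then 1 else 0)"
      using V(2)[unfolded isometry_index[OF V(1)]] pn ij by blast
    finally show "(\<Sum>k<n. cnj (U $$ (k, i)) * U $$ (k, j)) = (if i = j then 1 else 0)"
      using permutes_inj[OF p] by (simp add: inj_eq)
  qed
  have AU: "A * U = U * mat_diag n (\<lambda>i. complex_of_real (d i))"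
  proof (rule eq_matI)
    fix i j assume "i < dim_row (U * mat_diag n (\<lambda>i. complex_of_real (d i)))"
      "j < dim_col (U * mat_diag n (\<lambda>i. complex_of_real (d i)))"
    then have ij: "i < n" "j < n" using U by auto
    have "(A * U) $$ (i, j) = (\<Sum>k<n. A $$ (i, k) * V $$ (k, p j))"
      by (subst mult_mat_index_sum[OF A(1) U ij], intro sum.cong) (use ij in \<open>auto simp: U_def\<close>)
    also have "\<dots> = (A * V) $$ (i, p j)" by (rule mult_mat_index_sum[OF A(1) V(1) ij(1) pn[OF ij(2)], symmetric])
    also have "\<dots> = V $$ (i, p j) * l (p j)"
      using ij pn by (simp add: V(3) mat_diag_mult_right[OF V(1)])
    also have "\<dots> = (U * mat_diag n (\<lambda>i. complex_of_real (d i))) $$ (i, j)"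
      using ij pn re by (simp add: mat_diag_mult_right[OF U] d_def) (simp add: U_def)
    finally show "(A * U) $$ (i, j) = (U * mat_diag n (\<lambda>i. complex_of_real (d i))) $$ (i, j)" .
  qed (use A U in auto)
  have "A = A * (U * mat_adjoint U)" using A unitary_right[OF U UU] by simp
  also have "\<dots> = (A * U) * mat_adjoint U" using A U by (simp add: assoc_mult_mat[of _ n n _ n _ n])
  finally have "A = U * mat_diag n (\<lambda>i. complex_of_real (d i)) * mat_adjoint U" unfolding AU .
  then show ?thesis using U UU srt by (intro bexI[of _ U] exI[of _ d]) (auto simp: d_def)
qed

text \<open>This makes the definite description in \<open>eigvals\<close> meaningful. The head of a
  nonincreasing list is the largest root of its product, so the heads agree, and the common linear
  factor cancels.\<close>

lemma linear_factors_unique: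
  fixes xs ys :: "real list"
  assumes "length xs = length ys" "sorted_wrt (\<ge>) xs" "sorted_wrt (\<ge>) ys"
    "prod_list (map (\<lambda>x. [:- complex_of_real x, 1:]) xs) = prod_list (map (\<lambda>x. [:- complex_of_real x, 1:]) ys)"
  shows "xs = ys"
  using assms
proof (induction xs ys rule: list_induct2)
  case Nil
  then show ?case by simp
next
  case (Cons x xs y ys)
  have root: "poly (prod_list (map (\<lambda>x. [:- complex_of_real x, 1:]) zs)) (complex_of_real z) = 0 \<longleftrightarrow> z \<in> set zs"
    for z zs by (induction zs) auto
  have "x \<in> set (y # ys)" "y \<in> set (x # xs)"
    by (metis root Cons.prems(3) list.set_intros(1))+
  with Cons.prems(1,2) have "x = y" by (auto intro: antisym)
  with Cons show ?case by (simp del: mult_pCons_left)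
qed

text \<open>Similarity preserves the characteristic polynomial, and that of a diagonal matrix is the
  product of its linear factors. Hence \<open>eigvals\<close> can be read off any sorted unitary
  diagonalization.\<close>

lemma eigvals_eq:
  assumes U: "U \<in> carrier_mat n n" "mat_adjoint U * U = 1\<^sub>m n"
    and M: "M = U * mat_diag n (\<lambda>i. complex_of_real (l i)) * mat_adjoint U"
    and srt: "\<forall>i j. i \<le> j \<longrightarrow> j < n \<longrightarrow> l j \<le> l i"
  shows "eigvals M = map l [0..<n]"
proof -
  let ?D = "mat_diag n (\<lambda>i. complex_of_real (l i))"
  have cM: "M \<in> carrier_mat n n" using U by (auto simp: M)
  have "similar_mat_wit M ?D U (mat_adjoint U)"
    using U cM unitary_right[OF U] M by (intro similar_mat_witI[of _ _ n]) auto
  then have "char_poly M = char_poly ?D" by (intro char_poly_similar) (auto simp: similar_mat_def)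
  also have "\<dots> = (\<Prod>a\<leftarrow>diag_mat ?D. [:- a, 1:])"
    by (rule char_poly_upper_triangular[of _ n]) (auto simp: upper_triangular_def)
  also have "diag_mat ?D = map (\<lambda>i. complex_of_real (l i)) [0..<n]"
    by (auto simp: diag_mat_def)
  finally have cp: "char_poly M = prod_list (map (\<lambda>x. [:- complex_of_real x, 1:]) (map l [0..<n]))"
    by (simp add: comp_def)
  have s: "sorted_wrt (\<ge>) (map l [0..<n])" using srt by (auto simp: sorted_wrt_iff_nth_less)
  show ?thesis unfolding eigvals_def
  proof (rule the_equality)
    show "length (map l [0..<n]) = dim_row M \<and> sorted_wrt (\<ge>) (map l [0..<n]) \<and>
      char_poly M = prod_list (map (\<lambda>x. [:- complex_of_real x, 1:]) (map l [0..<n]))"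
      using cM s cp by auto
  next
    fix xs assume "length xs = dim_row M \<and> sorted_wrt (\<ge>) xs \<and>
      char_poly M = prod_list (map (\<lambda>x. [:- complex_of_real x, 1:]) xs)"
    then show "xs = map l [0..<n]" using cM s cp by (intro linear_factors_unique) auto
  qed
qed

lemma eigvals_diagonalization:
  assumes "A \<in> carrier_mat n n" "mat_adjoint A = A"
  shows "\<exists>U \<in> carrier_mat n n. mat_adjoint U * U = 1\<^sub>m n \<and>
    A = U * mat_diag n (\<lambda>i. complex_of_real (eigvals A ! i)) * mat_adjoint U"
    and "length (eigvals A) = n"
    and "i \<le> j \<Longrightarrow> j < n \<Longrightarrow> eigvals A ! j \<le> eigvals A ! i"
proof -
  obtain U l where U: "U \<in> carrier_mat n n" "mat_adjoint U * U = 1\<^sub>m n"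
    "A = U * mat_diag n (\<lambda>i. complex_of_real (l i)) * mat_adjoint U"
    and srt: "\<forall>i j. i \<le> j \<longrightarrow> j < n \<longrightarrow> l j \<le> l i"
    using hermitian_diagonalization[OF assms] by blast
  have e: "eigvals A = map l [0..<n]" by (rule eigvals_eq[OF U srt])
  have "mat_diag n (\<lambda>i. complex_of_real (eigvals A ! i)) = mat_diag n (\<lambda>i. complex_of_real (l i))"
    by (rule eq_matI) (auto simp: e)
  then have "A = U * mat_diag n (\<lambda>i. complex_of_real (eigvals A ! i)) * mat_adjoint U" using U(3) by simp
  then show "\<exists>U \<in> carrier_mat n n. mat_adjoint U * U = 1\<^sub>m n \<and>
    A = U * mat_diag n (\<lambda>i. complex_of_real (eigvals A ! i)) * mat_adjoint U" using U(1,2) by blast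
  show "length (eigvals A) = n" by (simp add: e)
  show "eigvals A ! j \<le> eigvals A ! i" if "i \<le> j" "j < n"
    using srt that by (simp add: e)
qed

lemma mat_diag_mult_vec_index:
  assumes "v \<in> carrier_vec n" "i < n"
  shows "(mat_diag n f *\<^sub>v v) $ i = f i * (v $ i :: complex)"
proof -
  have "(mat_diag n f *\<^sub>v v) $ i = (\<Sum>k<n. mat_diag n f $$ (i, k) * v $ k)"
    by (rule mult_mat_vec_index_sum[OF _ assms]) simp
  also have "\<dots> = (\<Sum>k<n. if i = k then f k * v $ k else 0)"
    using assms by (intro sum.cong) auto
  finally show ?thesis using assms by simp
qed

lemma quad_form_diagonalized:
  assumes U: "U \<in> carrier_mat n n" and v: "v \<in> carrier_vec n"
  shows "quad_form (U * mat_diag n (\<lambda>i. complex_of_real (l i)) * mat_adjoint U) v =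
    (\<Sum>i<n. l i * (cmod ((mat_adjoint U *\<^sub>v v) $ i))\<^sup>2)"
proof -
  let ?D = "mat_diag n (\<lambda>i. complex_of_real (l i))" and ?w = "mat_adjoint U *\<^sub>v v"
  have w: "?w \<in> carrier_vec n" using U v by (intro mult_mat_vec_carrier[of _ n n]) auto
  have Dw: "?D *\<^sub>v ?w \<in> carrier_vec n" by (rule mult_mat_vec_carrier[OF mat_diag_dim w])
  have "(U * ?D * mat_adjoint U) *\<^sub>v v = U *\<^sub>v (?D *\<^sub>v ?w)"
    using assoc_mult_mat_vec[OF _ mat_adjoint_carrier[OF U] v, of "U * ?D" n]
      assoc_mult_mat_vec[OF U _ w, of ?D] U by simp
  then have "((U * ?D * mat_adjoint U) *\<^sub>v v) \<bullet>c v = (?D *\<^sub>v ?w) \<bullet>c ?w"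
    using cscalar_prod_adjoint[OF U Dw v] by simp
  also have "\<dots> = (\<Sum>i<n. complex_of_real (l i * (cmod (?w $ i))\<^sup>2))"
    unfolding cscalar_prod_sum[OF w]
    by (intro sum.cong) (simp_all only: lessThan_iff mat_diag_mult_vec_index[OF w] complex_norm_square of_real_mult mult.assoc)
  finally show ?thesis unfolding quad_form_def by (simp flip: of_real_sum)
qed

lemma trace_diagonalized:
  fixes U :: "complex mat"
  assumes U: "U \<in> carrier_mat n n" "mat_adjoint U * U = 1\<^sub>m n"
  shows "(\<Sum>i<n. (U * mat_diag n l * mat_adjoint U) $$ (i, i)) = (\<Sum>i<n. l i)"
proof -
  have "(U * mat_diag n l * mat_adjoint U) $$ (i, i) = (\<Sum>k<n. U $$ (i, k) * l k * cnj (U $$ (i, k)))"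
    if "i < n" for i
    using U(1) that
    by (subst mult_mat_index_sum[of _ n n _ n])
      (auto simp: mat_diag_mult_right[of _ n] intro!: sum.cong)
  then have "(\<Sum>i<n. (U * mat_diag n l * mat_adjoint U) $$ (i, i)) =
    (\<Sum>i<n. \<Sum>k<n. U $$ (i, k) * l k * cnj (U $$ (i, k)))" by simp
  also have "\<dots> = (\<Sum>k<n. \<Sum>i<n. U $$ (i, k) * l k * cnj (U $$ (i, k)))" by (rule sum.swap)
  also have "\<dots> = (\<Sum>k<n. l k * (\<Sum>i<n. cnj (U $$ (i, k)) * U $$ (i, k)))"
    by (simp add: sum_distrib_left mult_ac)
  also have "\<dots> = (\<Sum>k<n. l k)"
    using U(2)[unfolded isometry_index[OF U(1)]] by (intro sum.cong) auto
  finally show ?thesis .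
qed

lemma sum_eigvals:
  assumes A: "A \<in> carrier_mat n n" "mat_adjoint A = A"
  shows "(\<Sum>i<n. eigvals A ! i) = Re (\<Sum>i<n. A $$ (i, i))"
proof -
  obtain U where U: "U \<in> carrier_mat n n" "mat_adjoint U * U = 1\<^sub>m n"
    "A = U * mat_diag n (\<lambda>i. complex_of_real (eigvals A ! i)) * mat_adjoint U"
    using eigvals_diagonalization(1)[OF A] by blast
  then have "(\<Sum>i<n. A $$ (i, i)) = (\<Sum>i<n. complex_of_real (eigvals A ! i))"
    using trace_diagonalized[OF U(1,2), of "\<lambda>i. complex_of_real (eigvals A ! i)"] by simp
  then show ?thesis by simp
qed

subsection \<open>Eigenvalue perturbation\<close>

text \<open>Weyl's monotonicity theorem by the Courant-Fischer argument: at the test vector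
  \<open>v\<close> the form of \<open>M\<close> is at least \<open>eigvals M ! i\<close> times
  \<open>norm_sq v\<close>, and that of \<open>N\<close> is at most \<open>eigvals N ! i\<close>
  times it.\<close>

lemma eigvals_mono_shift:
  assumes M: "M \<in> carrier_mat n n" "mat_adjoint M = M" and N: "N \<in> carrier_mat n n" "mat_adjoint N = N"
    and le: "\<And>v. v \<in> carrier_vec n \<Longrightarrow> quad_form M v \<le> quad_form N v + t * norm_sq v"
    and i: "i < n"
  shows "eigvals M ! i \<le> eigvals N ! i + t"
proof -
  obtain U where U: "U \<in> carrier_mat n n" "mat_adjoint U * U = 1\<^sub>m n"
    and MU: "M = U * mat_diag n (\<lambda>i. complex_of_real (eigvals M ! i)) * mat_adjoint U"
    using eigvals_diagonalization(1)[OF M] by blast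
  note sM = eigvals_diagonalization(3)[OF M]
  obtain W where W: "W \<in> carrier_mat n n" "mat_adjoint W * W = 1\<^sub>m n"
    and NW: "N = W * mat_diag n (\<lambda>i. complex_of_real (eigvals N ! i)) * mat_adjoint W"
    using eigvals_diagonalization(1)[OF N] by blast
  note sN = eigvals_diagonalization(3)[OF N]
  let ?WU = "mat_adjoint W * U"
  have WU: "?WU \<in> carrier_mat n n" using W U by (intro mult_carrier_mat[of _ n n]) auto
  \<comment> \<open>Dimension count: the first \<open>i + 1\<close> eigenvectors of \<open>M\<close> span a vector orthogonal to the first \<open>i\<close> eigenvectors of \<open>N\<close>.\<close>
  define G where "G = Matrix.mat i (Suc i) (\<lambda>(a, b). ?WU $$ (a, b))"
  have G: "G \<in> carrier_mat i (Suc i)" by (simp add: G_def)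
  obtain c where c: "c \<in> carrier_vec (Suc i)" "c \<noteq> 0\<^sub>v (Suc i)" "G *\<^sub>v c = 0\<^sub>v i"
    using exists_kernel_vec[OF G] by auto
  define x where "x = vec n (\<lambda>b. if b \<le> i then c $ b else 0)"
  have x: "x \<in> carrier_vec n" by (simp add: x_def)
  have x0: "x \<noteq> 0\<^sub>v n"
  proof
    assume x0: "x = 0\<^sub>v n"
    have "c = 0\<^sub>v (Suc i)"
    proof (rule eq_vecI)
      fix b assume "b < dim_vec (0\<^sub>v (Suc i) :: complex vec)"
      then have "b \<le> i" "b < n" using i by auto
      then show "c $ b = 0\<^sub>v (Suc i) $ b" using arg_cong[OF x0, of "\<lambda>v. v $ b"] by (simp add: x_def)
    qed (use c in auto)
    then show False using c by simp
  qed
  define v where "v = U *\<^sub>v x"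
  have v: "v \<in> carrier_vec n" unfolding v_def by (rule mult_mat_vec_carrier[OF U(1) x])
  have Uv: "mat_adjoint U *\<^sub>v v = x"
    unfolding v_def using assoc_mult_mat_vec[OF mat_adjoint_carrier[OF U(1)] U(1) x] U(2) x by simp
  let ?w = "mat_adjoint W *\<^sub>v v"
  have w: "?w \<in> carrier_vec n" by (rule mult_mat_vec_carrier[OF mat_adjoint_carrier[OF W(1)] v])
  have Wv: "?w = ?WU *\<^sub>v x"
    unfolding v_def using assoc_mult_mat_vec[OF mat_adjoint_carrier[OF W(1)] U(1) x] by simp
  have w0: "?w $ a = 0" if a: "a < i" for a
  proof -
    have "?w $ a = (\<Sum>b<n. ?WU $$ (a, b) * x $ b)"
      unfolding Wv using a i by (intro mult_mat_vec_index_sum[OF WU x]) simp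
    also have "\<dots> = (\<Sum>b<Suc i. ?WU $$ (a, b) * x $ b)"
      using i by (intro sum.mono_neutral_right) (auto simp: x_def)
    also have "\<dots> = (\<Sum>b<Suc i. G $$ (a, b) * c $ b)"
      using i a by (intro sum.cong) (auto simp: x_def G_def)
    also have "\<dots> = (G *\<^sub>v c) $ a" by (rule mult_mat_vec_index_sum[OF G c(1) a, symmetric])
    finally show ?thesis using c(3) a by simp
  qed
  have nv: "norm_sq v = norm_sq x" unfolding v_def by (rule norm_sq_isometry[OF U x])
  have nw: "norm_sq ?w = norm_sq v"
    using norm_sq_isometry[OF mat_adjoint_carrier[OF W(1)] _ v] unitary_right[OF W] by simp
  have "eigvals M ! i * norm_sq x = (\<Sum>b<n. eigvals M ! i * (cmod (x $ b))\<^sup>2)"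
    by (simp add: norm_sq_sum[OF x] sum_distrib_left)
  also have "\<dots> \<le> (\<Sum>b<n. eigvals M ! b * (cmod (x $ b))\<^sup>2)"
  proof (rule sum_mono)
    fix b assume "b \<in> {..<n}"
    then show "eigvals M ! i * (cmod (x $ b))\<^sup>2 \<le> eigvals M ! b * (cmod (x $ b))\<^sup>2"
      using sM[of b i] i by (cases "b \<le> i") (auto simp: x_def intro: mult_right_mono)
  qed
  also have "\<dots> = quad_form M v" by (subst MU, subst quad_form_diagonalized[OF U(1) v]) (simp add: Uv)
  also have "\<dots> \<le> quad_form N v + t * norm_sq v" by (rule le[OF v])
  also have "quad_form N v = (\<Sum>a<n. eigvals N ! a * (cmod (?w $ a))\<^sup>2)"
    by (subst NW, subst quad_form_diagonalized[OF W(1) v]) simp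
  also have "\<dots> \<le> (\<Sum>a<n. eigvals N ! i * (cmod (?w $ a))\<^sup>2)"
  proof (rule sum_mono)
    fix a assume "a \<in> {..<n}"
    then show "eigvals N ! a * (cmod (?w $ a))\<^sup>2 \<le> eigvals N ! i * (cmod (?w $ a))\<^sup>2"
      using sN[of i a] w0[of a] i by (cases "a < i") (auto intro: mult_right_mono simp del: index_mult_mat_vec)
  qed
  also have "\<dots> = eigvals N ! i * norm_sq ?w" by (simp only: norm_sq_sum[OF w] sum_distrib_left)
  finally have "eigvals M ! i * norm_sq x \<le> (eigvals N ! i + t) * norm_sq x"
    by (simp add: nv nw algebra_simps)
  then show ?thesis using norm_sq_pos[OF x x0] by simp
qed

lemma quad_form_add:
  assumes "M \<in> carrier_mat n n" "N \<in> carrier_mat n n" "v \<in> carrier_vec n"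
  shows "quad_form (M + N) v = quad_form M v + quad_form N v"
  using assms add_mult_distrib_mat_vec[OF assms] 
    add_scalar_prod_distrib[of "M *\<^sub>v v" n "N *\<^sub>v v" "conjugate v"]
  by (simp add: quad_form_def)

lemma quad_form_diff:
  assumes "M \<in> carrier_mat n n" "N \<in> carrier_mat n n" "v \<in> carrier_vec n"
  shows "quad_form (M - N) v = quad_form M v - quad_form N v"
  using assms minus_mult_distrib_mat_vec[OF assms] 
    minus_scalar_prod_distrib[of "M *\<^sub>v v" n "N *\<^sub>v v" "conjugate v"]
  by (simp add: quad_form_def)

text \<open>Since \<open>M \<le> (N + P) + t\<close> and all eigenvalue gaps between \<open>N\<close> and \<open>N + P\<close> are nonnegative,
  a partial sum of gaps is at most the full one, which is the trace of \<open>P\<close>.\<close>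

lemma sum_eigvals_diff_le:
  assumes M: "M \<in> carrier_mat n n" "mat_adjoint M = M" and N: "N \<in> carrier_mat n n" "mat_adjoint N = N"
    and P: "P \<in> carrier_mat n n" "mat_adjoint P = P" "\<And>v. v \<in> carrier_vec n \<Longrightarrow> 0 \<le> quad_form P v"
    and le: "\<And>v. v \<in> carrier_vec n \<Longrightarrow> quad_form M v \<le> quad_form N v + quad_form P v + t * norm_sq v"
    and I: "I \<subseteq> {..<n}"
  shows "(\<Sum>i\<in>I. eigvals M ! i - eigvals N ! i) \<le> t * card I + Re (\<Sum>i<n. P $$ (i, i))"
proof -
  have Q: "N + P \<in> carrier_mat n n" using N P by simp
  have "mat_adjoint (N + P) = mat_adjoint N + mat_adjoint P"
    using N(1) P(1) by (intro eq_matI) auto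
  then have hQ: "mat_adjoint (N + P) = N + P" using N P by simp
  have 1: "eigvals M ! i \<le> eigvals (N + P) ! i + t" if "i < n" for i
    using that by (intro eigvals_mono_shift[OF M Q hQ]) (simp_all add: quad_form_add[OF N(1) P(1)] le)
  have 2: "eigvals N ! i \<le> eigvals (N + P) ! i" if "i < n" for i
    using that eigvals_mono_shift[OF N Q hQ, of 0 i] P(3) by (simp add: quad_form_add[OF N(1) P(1)])
  have "(\<Sum>i\<in>I. eigvals M ! i - eigvals N ! i) \<le> (\<Sum>i\<in>I. t + (eigvals (N + P) ! i - eigvals N ! i))"
    using 1 I by (intro sum_mono) (force simp: algebra_simps)
  also have "\<dots> = t * card I + (\<Sum>i\<in>I. eigvals (N + P) ! i - eigvals N ! i)"
    by (simp add: sum.distrib)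
  also have "(\<Sum>i\<in>I. eigvals (N + P) ! i - eigvals N ! i) \<le> (\<Sum>i<n. eigvals (N + P) ! i - eigvals N ! i)"
    using 2 I by (intro sum_mono2) auto
  also have "\<dots> = Re (\<Sum>i<n. P $$ (i, i))"
    using N P by (simp add: sum_subtractf sum_eigvals[OF Q hQ] sum_eigvals[OF N] sum.distrib)
  finally show ?thesis by simp
qed

lemma exists_top_set:
  fixes f :: "nat \<Rightarrow> real"
  assumes "m \<le> n" "\<And>i. 0 \<le> f i"
  shows "\<exists>J t. J \<subseteq> {..<n} \<and> card J = m \<and> 0 \<le> t \<and> (\<forall>i\<in>J. t \<le> f i) \<and> (\<forall>i\<in>{..<n} - J. f i \<le> t)"
proof (cases "m = 0")
  case True
  \<comment> \<open>For \<open>m = 0\<close> there is no smallest selected value to serve as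
    \<open>t\<close>; the sum of all values is a level above each of them.\<close>
  have "f i \<le> (\<Sum>i<n. f i)" if "i < n" for i
    using assms(2) that by (intro member_le_sum) auto
  then show ?thesis using True assms(2) by (intro exI[of _ "{}"] exI[of _ "\<Sum>i<n. f i"]) (auto intro: sum_nonneg)
next
  case False
  obtain p where p: "p permutes {..<n}" and srt: "\<forall>i j. i \<le> j \<longrightarrow> j < n \<longrightarrow> f (p j) \<le> f (p i)"
    using exists_sorting_permutation[of n f] by blast
  have im: "p ` {..<n} = {..<n}" using p by (rule permutes_image)
  have inj: "inj p" using p by (rule permutes_inj)
  show ?thesis
  \<comment> \<open>After sorting, \<open>J\<close> holds the first \<open>m\<close> positions and
    \<open>t\<close> is the \<open>m\<close>-th largest value, found at position
    \<open>m - 1\<close>.\<close>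
  proof (intro exI[of _ "p ` {..<m}"] exI[of _ "f (p (m - 1))"] conjI ballI)
    show "p ` {..<m} \<subseteq> {..<n}" using im \<open>m \<le> n\<close> by (metis image_mono lessThan_subset_iff)
    show "card (p ` {..<m}) = m" using inj by (simp add: card_image inj_on_subset)
    fix i assume i: "i \<in> {..<n} - p ` {..<m}"
    then obtain j where j: "i = p j" "j < n" using im by auto
    with i have "m \<le> j" by (metis DiffE imageI lessThan_iff not_le)
    then show "f i \<le> f (p (m - 1))" using srt j by simp
  qed (use assms False srt in auto)
qed

text \<open>Mirsky's inequality. With \<open>D = M - N\<close> and \<open>t\<close> the \<open>card I\<close>-th largest modulus of an eigenvalue of \<open>D\<close>, apply the
  previous bound to \<open>D \<le> t + (D - t)\<^sub>+\<close> where the gap is nonnegative and to \<open>- D \<le> t + (- D - t)\<^sub>+\<close> elsewhere.\<close>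

lemma sum_abs_eigvals_diff_le:
  assumes M: "M \<in> carrier_mat n n" "mat_adjoint M = M" and N: "N \<in> carrier_mat n n" "mat_adjoint N = N"
    and I: "I \<subseteq> {..<n}"
  shows "\<exists>V \<in> carrier_mat n n. \<exists>J. mat_adjoint V * V = 1\<^sub>m n \<and> J \<subseteq> {..<n} \<and> card J = card I \<and>
    (\<Sum>i\<in>I. \<bar>eigvals M ! i - eigvals N ! i\<bar>) \<le> (\<Sum>l\<in>J. \<bar>quad_form M (col V l) - quad_form N (col V l)\<bar>)"
proof -
  have D: "M - N \<in> carrier_mat n n" by (rule minus_carrier_mat[OF N(1)])
  have "mat_adjoint (M - N) = mat_adjoint M - mat_adjoint N" using M(1) N(1) by (intro eq_matI) auto
  then have hD: "mat_adjoint (M - N) = M - N" using M N by simp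
  obtain V d where V: "V \<in> carrier_mat n n" "mat_adjoint V * V = 1\<^sub>m n"
    and DV: "M - N = V * mat_diag n (\<lambda>i. complex_of_real (d i)) * mat_adjoint V"
    using hermitian_diagonalization[OF D hD] by blast
  have fI: "finite I" using I finite_subset by auto
  have "card I \<le> n" using card_mono[OF _ I] by simp
  then obtain J t where J: "J \<subseteq> {..<n}" "card J = card I" and t: "0 \<le> t"
    and Jt: "\<forall>i\<in>J. t \<le> \<bar>d i\<bar>" "\<forall>i\<in>{..<n} - J. \<bar>d i\<bar> \<le> t"
    using exists_top_set[of "card I" n "\<lambda>i. \<bar>d i\<bar>"] by auto
  \<comment> \<open>The columns of \<open>V\<close> are eigenvectors of \<open>M - N\<close>, so the
    form recovers the eigenvalue. Expressing the conclusion through these columns allows later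
    estimates to work with vectors alone.\<close>
  have qV: "quad_form M (col V l) - quad_form N (col V l) = d l" if l: "l < n" for l
  proof -
    have cl: "col V l \<in> carrier_vec n" using V l by auto
    have u: "(mat_adjoint V *\<^sub>v col V l) $ i = (if i = l then 1 else 0)" if "i < n" for i
    proof -
      have "(mat_adjoint V *\<^sub>v col V l) $ i = (mat_adjoint V * V) $$ (i, l)"
        using V(1) l that by simp
      then show ?thesis using V(2) l that by simp
    qed
    have "quad_form M (col V l) - quad_form N (col V l) = quad_form (M - N) (col V l)"
      using quad_form_diff[OF M(1) N(1) cl] by simp
    also have "\<dots> = (\<Sum>i<n. d i * (cmod ((mat_adjoint V *\<^sub>v col V l) $ i))\<^sup>2)"
      unfolding DV by (rule quad_form_diagonalized[OF V(1) cl])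
    also have "\<dots> = (\<Sum>i<n. if i = l then d i else 0)"
      using u by (intro sum.cong) (auto simp del: index_mult_mat_vec)
    finally show ?thesis using l by simp
  qed
  \<comment> \<open>With \<open>D = M - N\<close>, \<open>Q 1\<close> is the positive part of
    \<open>D - t\<close> and \<open>Q (-1)\<close> that of \<open>- D - t\<close>; the sign
    \<open>s\<close> treats both at once.\<close>
  define Q where "Q s = V * mat_diag n (\<lambda>i. complex_of_real (max 0 (s * d i - t))) * mat_adjoint V" for s :: real
  have cQ: "Q s \<in> carrier_mat n n" for s unfolding Q_def using V by auto
  have hQ: "mat_adjoint (Q s) = Q s" for s
  proof -
    let ?D = "mat_diag n (\<lambda>i. complex_of_real (max 0 (s * d i - t)))"
    have "mat_adjoint (Q s) = V * (?D * mat_adjoint V)"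
      unfolding Q_def using V(1)
      by (simp add: mat_adjoint_mult[of _ n n _ n] mat_adjoint_mult[of V n n ?D n])
    also have "\<dots> = Q s" unfolding Q_def using V(1) by (simp add: assoc_mult_mat[of V n n ?D n "mat_adjoint V" n])
    finally show ?thesis .
  qed
  have pQ: "0 \<le> quad_form (Q s) v" if "v \<in> carrier_vec n" for s v
    unfolding Q_def quad_form_diagonalized[OF V(1) that] by (intro sum_nonneg) auto
  have DQ: "s * quad_form (M - N) v \<le> quad_form (Q s) v + t * norm_sq v" if v: "v \<in> carrier_vec n" for s v
  proof -
    let ?w = "mat_adjoint V *\<^sub>v v"
    have w: "?w \<in> carrier_vec n" by (rule mult_mat_vec_carrier[OF mat_adjoint_carrier[OF V(1)] v])
    have nw: "norm_sq v = norm_sq ?w"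
      using norm_sq_isometry[OF mat_adjoint_carrier[OF V(1)] _ v] unitary_right[OF V] by simp
    have "s * quad_form (M - N) v = (\<Sum>i<n. s * d i * (cmod (?w $ i))\<^sup>2)"
      unfolding DV quad_form_diagonalized[OF V(1) v] by (simp add: sum_distrib_left mult.assoc)
    also have "\<dots> \<le> (\<Sum>i<n. (max 0 (s * d i - t) + t) * (cmod (?w $ i))\<^sup>2)"
      by (intro sum_mono mult_right_mono) auto
    also have "\<dots> = quad_form (Q s) v + t * norm_sq v"
      unfolding Q_def quad_form_diagonalized[OF V(1) v] nw norm_sq_sum[OF w]
      by (simp only: sum_distrib_left distrib_right sum.distrib)
    finally show ?thesis .
  qed
  have trQ: "Re (\<Sum>i<n. Q s $$ (i, i)) = (\<Sum>i<n. max 0 (s * d i - t))" for s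
    unfolding Q_def trace_diagonalized[OF V] by (simp flip: of_real_sum)
  define I1 where "I1 = {i \<in> I. eigvals N ! i \<le> eigvals M ! i}"
  define I2 where "I2 = I - I1"
  have I12: "I = I1 \<union> I2" "I1 \<inter> I2 = {}" "finite I1" "finite I2" "I1 \<subseteq> {..<n}" "I2 \<subseteq> {..<n}"
    using fI I by (auto simp: I1_def I2_def)
  have le1: "(\<Sum>i\<in>I1. eigvals M ! i - eigvals N ! i) \<le> t * card I1 + Re (\<Sum>i<n. Q 1 $$ (i, i))"
  proof (rule sum_eigvals_diff_le[OF M N cQ hQ pQ _ I12(5)])
    fix v :: "complex vec" assume v: "v \<in> carrier_vec n"
    then show "quad_form M v \<le> quad_form N v + quad_form (Q 1) v + t * norm_sq v"
      using DQ[OF v, of 1] quad_form_diff[OF M(1) N(1) v] by simp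
  qed
  have le2: "(\<Sum>i\<in>I2. eigvals N ! i - eigvals M ! i) \<le> t * card I2 + Re (\<Sum>i<n. Q (-1) $$ (i, i))"
  proof (rule sum_eigvals_diff_le[OF N M cQ hQ pQ _ I12(6)])
    fix v :: "complex vec" assume v: "v \<in> carrier_vec n"
    then show "quad_form N v \<le> quad_form M v + quad_form (Q (-1)) v + t * norm_sq v"
      using DQ[OF v, of "-1"] quad_form_diff[OF M(1) N(1) v] by simp
  qed
  have "(\<Sum>i\<in>I. \<bar>eigvals M ! i - eigvals N ! i\<bar>) =
    (\<Sum>i\<in>I1. \<bar>eigvals M ! i - eigvals N ! i\<bar>) + (\<Sum>i\<in>I2. \<bar>eigvals M ! i - eigvals N ! i\<bar>)"
    unfolding I12(1) using I12 by (intro sum.union_disjoint) auto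
  also have "(\<Sum>i\<in>I1. \<bar>eigvals M ! i - eigvals N ! i\<bar>) = (\<Sum>i\<in>I1. eigvals M ! i - eigvals N ! i)"
    by (intro sum.cong) (auto simp: I1_def)
  also have "(\<Sum>i\<in>I2. \<bar>eigvals M ! i - eigvals N ! i\<bar>) = (\<Sum>i\<in>I2. eigvals N ! i - eigvals M ! i)"
    by (intro sum.cong) (auto simp: I1_def I2_def)
  finally have "(\<Sum>i\<in>I. \<bar>eigvals M ! i - eigvals N ! i\<bar>) \<le>
    t * (real (card I1) + real (card I2)) + (\<Sum>i<n. max 0 (1 * d i - t) + max 0 (-1 * d i - t))"
    using le1 le2 unfolding trQ by (simp add: sum.distrib algebra_simps)
  also have "real (card I1) + real (card I2) = card J"
    using J I12 by (simp add: card_Un_disjoint)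
  \<comment> \<open>As \<open>t\<close> is nonnegative, at most one of the two positive parts is
    nonzero for each eigenvalue. So charging \<open>I1\<close> and \<open>I2\<close> with the full
    trace of their own part counts nothing twice.\<close>
  also have "(\<Sum>i<n. max 0 (1 * d i - t) + max 0 (-1 * d i - t)) = (\<Sum>i<n. max 0 (\<bar>d i\<bar> - t))"
    using t by (intro sum.cong) (auto simp: max_def)
  \<comment> \<open>Eigenvalues outside \<open>J\<close> have modulus at most \<open>t\<close> and
    drop out; those in \<open>J\<close> regain the lost \<open>t\<close> from the term
    \<open>t * card J\<close>.\<close>
  also have "\<dots> = (\<Sum>i\<in>J. \<bar>d i\<bar> - t)"
    using J(1) Jt by (intro sum.mono_neutral_cong_right) (auto simp: max_def intro: antisym)
  also have "t * card J + \<dots> = (\<Sum>i\<in>J. \<bar>d i\<bar>)" by (simp add: sum_subtractf)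
  also have "\<dots> = (\<Sum>l\<in>J. \<bar>quad_form M (col V l) - quad_form N (col V l)\<bar>)"
    using qV J(1) by (intro sum.cong) auto
  finally show ?thesis using V J by blast
qed

subsection \<open>Singular values\<close>

text \<open>The columns of \<open>H\<close> are orthogonal with lengths \<open>c\<close>.
  Normalizing them gives left singular vectors, and a zero column is replaced by any unit vector
  orthogonal to the earlier ones. The order of \<open>c\<close> matters: if \<open>c m\<close> is
  positive, so are all earlier \<open>c j\<close>, and orthogonality of the new column follows from
  that of \<open>H\<close> by division.\<close>

lemma orthogonal_cols_factor:
  fixes c :: "nat \<Rightarrow> real"
  assumes H: "H \<in> carrier_mat k k" "mat_adjoint H * H = mat_diag k (\<lambda>i. complex_of_real ((c i)\<^sup>2))"
    and c: "\<And>i. i < k \<Longrightarrow> 0 \<le> c i" "\<And>i j. i \<le> j \<Longrightarrow> j < k \<Longrightarrow> c j \<le> c i"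
    and "m \<le> k"
  shows "\<exists>U \<in> carrier_mat k m. mat_adjoint U * U = 1\<^sub>m m \<and>
    (\<forall>i<k. \<forall>j<m. H $$ (i, j) = U $$ (i, j) * complex_of_real (c j))"
  using \<open>m \<le> k\<close>
proof (induction m)
  case 0
  show ?case by (rule bexI[of _ "0\<^sub>m k 0"], intro conjI eq_matI) auto
next
  case (Suc m)
  then obtain U where U: "U \<in> carrier_mat k m" "mat_adjoint U * U = 1\<^sub>m m"
    and HU: "\<And>i j. i < k \<Longrightarrow> j < m \<Longrightarrow> H $$ (i, j) = U $$ (i, j) * complex_of_real (c j)"
    by auto
  have m: "m < k" using Suc.prems by simp
  have HH: "(\<Sum>a<k. cnj (H $$ (a, i)) * H $$ (a, j)) = (if i = j then complex_of_real ((c j)\<^sup>2) else 0)"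
    if "i < k" "j < k" for i j
    unfolding adjoint_mult_index[OF H(1) H(1) that, symmetric] H(2) using that by simp
  have "\<exists>v \<in> carrier_vec k. norm_sq v = 1 \<and> mat_adjoint U *\<^sub>v v = 0\<^sub>v m \<and>
    (\<forall>i<k. H $$ (i, m) = v $ i * complex_of_real (c m))"
  proof (cases "c m = 0")
    case True
    have "(\<Sum>a<k. complex_of_real ((cmod (H $$ (a, m)))\<^sup>2)) = 0"
      using HH[OF m m] True by (simp add: complex_norm_square mult.commute del: of_real_power)
    then have "(\<Sum>a<k. (cmod (H $$ (a, m)))\<^sup>2) = 0"
      by (metis of_real_eq_0_iff of_real_sum)
    then have "H $$ (i, m) = 0" if "i < k" for i using that by (auto simp: sum_nonneg_eq_0_iff)
    then show ?thesis using exists_unit_orthogonal[OF U(1) m] True by auto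
  next
    case False
    then have cm: "0 < c m" using c(1)[OF m] by simp
    define v where "v = vec k (\<lambda>i. H $$ (i, m) / complex_of_real (c m))"
    have v: "v \<in> carrier_vec k" by (simp add: v_def)
    have "complex_of_real (norm_sq v) = (\<Sum>i<k. v $ i * cnj (v $ i))"
      by (simp only: norm_sq_cscalar cscalar_prod_sum[OF v])
    also have "\<dots> = (\<Sum>i<k. cnj (H $$ (i, m)) * H $$ (i, m)) / complex_of_real ((c m)\<^sup>2)"
      unfolding sum_divide_distrib
      by (intro sum.cong) (auto simp: v_def power2_eq_square)
    also have "\<dots> = 1" unfolding HH[OF m m] using cm by simp
    finally have n1: "norm_sq v = 1" by (metis of_real_eq_1_iff)
    have "mat_adjoint U *\<^sub>v v = 0\<^sub>v m"
    proof (rule eq_vecI)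
      fix j assume "j < dim_vec (0\<^sub>v m :: complex vec)"
      then have j: "j < m" by simp
      have cj: "0 < c j" using c(2)[of j m] cm j m by simp
      have "(mat_adjoint U *\<^sub>v v) $ j = (\<Sum>i<k. mat_adjoint U $$ (j, i) * v $ i)"
        by (rule mult_mat_vec_index_sum[OF mat_adjoint_carrier[OF U(1)] v j])
      also have "\<dots> = (\<Sum>i<k. cnj (H $$ (i, j)) * H $$ (i, m)) / (complex_of_real (c j) * complex_of_real (c m))"
        unfolding sum_divide_distrib
        using j U(1) cj cm by (intro sum.cong) (auto simp: v_def HU)
      also have "\<dots> = 0" using HH[of j m] j m by simp
      finally show "(mat_adjoint U *\<^sub>v v) $ j = 0\<^sub>v m $ j" using j by simp
    qed (use U in auto)
    then show ?thesis using v n1 cm by (intro bexI[of _ v]) (auto simp: v_def)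
  qed
  then obtain v where v: "v \<in> carrier_vec k" "norm_sq v = 1" "mat_adjoint U *\<^sub>v v = 0\<^sub>v m"
    and Hv: "\<And>i. i < k \<Longrightarrow> H $$ (i, m) = v $ i * complex_of_real (c m)" by auto
  show ?case
    using append_col_carrier[OF U(1)] isometry_append_col[OF U v] HU Hv
    by (intro bexI[of _ "append_col U v"]) (auto simp: append_col_index[OF U(1)] less_Suc_eq)
qed

lemma adjoint_mult_self_svd:
  assumes U: "U \<in> carrier_mat k k" "mat_adjoint U * U = 1\<^sub>m k" and V: "V \<in> carrier_mat k k"
    and G: "G = U * mat_diag k (\<lambda>i. complex_of_real (c i)) * mat_adjoint V"
  shows "mat_adjoint G * G = V * mat_diag k (\<lambda>i. complex_of_real ((c i)\<^sup>2)) * mat_adjoint V"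
proof -
  let ?C = "mat_diag k (\<lambda>i. complex_of_real (c i))"
  have C: "?C \<in> carrier_mat k k" by simp
  note cs = U(1) V C mat_adjoint_carrier[OF U(1)] mat_adjoint_carrier[OF V]
  have UC: "U * ?C \<in> carrier_mat k k" and CV: "?C * mat_adjoint V \<in> carrier_mat k k"
    and VC: "V * ?C \<in> carrier_mat k k"
    using cs by (auto intro: mult_carrier_mat)
  have aG: "mat_adjoint G = V * (?C * mat_adjoint U)"
    unfolding G using mat_adjoint_mult[OF UC cs(5)] mat_adjoint_mult[OF cs(1,3)] by simp
  have "mat_adjoint G * G = (V * ?C * mat_adjoint U) * (U * (?C * mat_adjoint V))"
    unfolding aG unfolding G
    using assoc_mult_mat[OF cs(2,3,4)] assoc_mult_mat[OF cs(1,3,5)] by simp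
  also have "\<dots> = V * ?C * (mat_adjoint U * (U * (?C * mat_adjoint V)))"
    by (rule assoc_mult_mat[OF VC cs(4) mult_carrier_mat[OF cs(1) CV]])
  also have "mat_adjoint U * (U * (?C * mat_adjoint V)) = ?C * mat_adjoint V"
    using assoc_mult_mat[OF cs(4,1) CV] U(2) CV by simp
  also have "V * ?C * (?C * mat_adjoint V) = V * (?C * ?C) * mat_adjoint V"
    using assoc_mult_mat[OF VC cs(3,5)] assoc_mult_mat[OF cs(2,3,3)] by simp
  also have "?C * ?C = mat_diag k (\<lambda>i. complex_of_real ((c i)\<^sup>2))"
    by (simp add: power2_eq_square)
  finally show ?thesis .
qed

lemma sing_vals_eq:
  assumes U: "U \<in> carrier_mat k k" "mat_adjoint U * U = 1\<^sub>m k"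
    and V: "V \<in> carrier_mat k k" "mat_adjoint V * V = 1\<^sub>m k"
    and G: "G = U * mat_diag k (\<lambda>i. complex_of_real (c i)) * mat_adjoint V"
    and c: "\<And>i. i < k \<Longrightarrow> 0 \<le> c i" "\<And>i j. i \<le> j \<Longrightarrow> j < k \<Longrightarrow> c j \<le> c i"
  shows "sing_vals G = map c [0..<k]"
proof -
  have "eigvals (mat_adjoint G * G) = map (\<lambda>i. (c i)\<^sup>2) [0..<k]"
    by (rule eigvals_eq[OF V adjoint_mult_self_svd[OF U V(1) G]]) (use c in \<open>auto intro!: power_mono\<close>)
  then show ?thesis using c(1) by (simp add: sing_vals_def)
qed

text \<open>\<open>V\<close> diagonalizes \<open>G\<^sup>H G\<close>, so the columns of
  \<open>H = G V\<close> are orthogonal with squared lengths \<open>l i\<close>. In particular the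
  \<open>l i\<close> are nonnegative, their square roots are the singular values, and normalizing
  the columns gives \<open>U\<close>.\<close>

lemma singular_value_decomposition:
  assumes G: "G \<in> carrier_mat k k"
  obtains U V c where "U \<in> carrier_mat k k" "mat_adjoint U * U = 1\<^sub>m k"
    "V \<in> carrier_mat k k" "mat_adjoint V * V = 1\<^sub>m k"
    "G = U * mat_diag k (\<lambda>i. complex_of_real (c i)) * mat_adjoint V"
    "\<forall>i<k. 0 \<le> c i" "\<forall>i j. i \<le> j \<longrightarrow> j < k \<longrightarrow> c j \<le> c i"
proof -
  let ?B = "mat_adjoint G * G"
  have B: "?B \<in> carrier_mat k k" using G by (intro mult_carrier_mat[of _ k k]) auto
  have hB: "mat_adjoint ?B = ?B" using mat_adjoint_mult[OF mat_adjoint_carrier[OF G] G] by simp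
  obtain V l where V: "V \<in> carrier_mat k k" "mat_adjoint V * V = 1\<^sub>m k"
    and BV: "?B = V * mat_diag k (\<lambda>i. complex_of_real (l i)) * mat_adjoint V"
    and srt: "\<forall>i j. i \<le> j \<longrightarrow> j < k \<longrightarrow> l j \<le> l i"
    using hermitian_diagonalization[OF B hB] by blast
  let ?L = "mat_diag k (\<lambda>i. complex_of_real (l i))"
  have L: "?L \<in> carrier_mat k k" by simp
  define H where "H = G * V"
  have H: "H \<in> carrier_mat k k" unfolding H_def by (rule mult_carrier_mat[OF G V(1)])
  have "mat_adjoint H * H = mat_adjoint V * (mat_adjoint G * (G * V))"
    unfolding H_def mat_adjoint_mult[OF G V(1)]
    by (rule assoc_mult_mat[OF mat_adjoint_carrier[OF V(1)] mat_adjoint_carrier[OF G] mult_carrier_mat[OF G V(1)]])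
  also have "mat_adjoint G * (G * V) = ?B * V"
    using assoc_mult_mat[OF mat_adjoint_carrier[OF G] G V(1)] by simp
  also have "?B * V = V * ?L * (mat_adjoint V * V)"
    unfolding BV using V(1) by (intro assoc_mult_mat[of _ k k _ k _ k]) (auto intro: mult_carrier_mat)
  also have "\<dots> = V * ?L" using V by (simp add: right_mult_one_mat[OF mult_carrier_mat[OF V(1) L]])
  also have "mat_adjoint V * (V * ?L) = ?L"
    using assoc_mult_mat[OF mat_adjoint_carrier[OF V(1)] V(1) L] V(2) by (simp add: left_mult_one_mat[OF L])
  finally have HH: "mat_adjoint H * H = ?L" .
  have l0: "0 \<le> l i" if i: "i < k" for i
  proof -
    have "complex_of_real (l i) = (\<Sum>a<k. cnj (H $$ (a, i)) * H $$ (a, i))"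
      using adjoint_mult_index[OF H H i i] i HH by simp
    also have "\<dots> = complex_of_real (\<Sum>a<k. (cmod (H $$ (a, i)))\<^sup>2)"
      by (simp add: complex_norm_square mult.commute del: of_real_power)
    finally have "l i = (\<Sum>a<k. (cmod (H $$ (a, i)))\<^sup>2)" by (metis of_real_eq_iff)
    then show ?thesis by (simp add: sum_nonneg)
  qed
  have Lc: "?L = mat_diag k (\<lambda>i. complex_of_real ((sqrt (l i))\<^sup>2))"
    by (rule eq_matI) (auto simp: l0 simp del: of_real_power)
  obtain U where U: "U \<in> carrier_mat k k" "mat_adjoint U * U = 1\<^sub>m k"
    and HU: "\<forall>i<k. \<forall>j<k. H $$ (i, j) = U $$ (i, j) * complex_of_real (sqrt (l j))"
    using orthogonal_cols_factor[OF H HH[unfolded Lc] _ _ order_refl] l0 srt by auto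
  let ?C = "mat_diag k (\<lambda>i. complex_of_real (sqrt (l i)))"
  have HC: "H = U * ?C"
    using H U(1) HU by (intro eq_matI) (auto simp: mat_diag_mult_right[of _ k] simp del: index_mult_mat(1))
  have "G = G * (V * mat_adjoint V)" using G unitary_right[OF V] by simp
  also have "\<dots> = H * mat_adjoint V"
    unfolding H_def by (rule assoc_mult_mat[symmetric, OF G V(1) mat_adjoint_carrier[OF V(1)]])
  finally have "G = U * ?C * mat_adjoint V" unfolding HC .
  then show ?thesis using l0 srt by (intro that[OF U V, of "\<lambda>i. sqrt (l i)"]) auto
qed

subsection \<open>Contractions and weights\<close>

lemma quad_form_polarization:
  assumes M: "M \<in> carrier_mat n n" "mat_adjoint M = M" and u: "u \<in> carrier_vec n" and v: "v \<in> carrier_vec n"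
  shows "quad_form M (u + v) = quad_form M u + quad_form M v + 2 * Re ((M *\<^sub>v u) \<bullet>c v)"
    and "quad_form M (u - v) = quad_form M u + quad_form M v - 2 * Re ((M *\<^sub>v u) \<bullet>c v)"
proof -
  have Mu: "M *\<^sub>v u \<in> carrier_vec n" and Mv: "M *\<^sub>v v \<in> carrier_vec n"
    using mult_mat_vec_carrier[OF M(1)] u v by auto
  have "(M *\<^sub>v v) \<bullet>c u = v \<bullet>c (M *\<^sub>v u)" using cscalar_prod_adjoint[OF M(1) v u] M(2) by simp
  also have "\<dots> = cnj ((M *\<^sub>v u) \<bullet>c v)"
    by (simp only: cscalar_prod_sum[OF Mu] cscalar_prod_sum[OF v] cnj_sum complex_cnj_mult complex_cnj_cnj)
      (simp add: mult.commute)
  finally have *: "Re ((M *\<^sub>v v) \<bullet>c u) = Re ((M *\<^sub>v u) \<bullet>c v)" by simp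
  have uv: "u + v \<in> carrier_vec n" "u - v \<in> carrier_vec n" using u v by auto
  have "(M *\<^sub>v (u + v)) \<bullet>c (u + v) = (M *\<^sub>v u) \<bullet>c u + (M *\<^sub>v u) \<bullet>c v + (M *\<^sub>v v) \<bullet>c u + (M *\<^sub>v v) \<bullet>c v"
    unfolding mult_add_distrib_mat_vec[OF M(1) u v] cscalar_prod_sum[OF uv(1)] cscalar_prod_sum[OF u] cscalar_prod_sum[OF v]
      sum.distrib[symmetric]
    using u v Mu Mv M(1) by (intro sum.cong) (auto simp: algebra_simps simp del: index_mult_mat_vec)
  then show "quad_form M (u + v) = quad_form M u + quad_form M v + 2 * Re ((M *\<^sub>v u) \<bullet>c v)"
    using * by (simp add: quad_form_def)
  have "(M *\<^sub>v (u - v)) \<bullet>c (u - v) = (M *\<^sub>v u) \<bullet>c u - (M *\<^sub>v u) \<bullet>c v - (M *\<^sub>v v) \<bullet>c u + (M *\<^sub>v v) \<bullet>c v"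
    unfolding mult_minus_distrib_mat_vec[OF M(1) u v] cscalar_prod_sum[OF uv(2)] cscalar_prod_sum[OF u] cscalar_prod_sum[OF v]
      sum.distrib[symmetric] sum_subtractf[symmetric]
    using u v Mu Mv M(1) by (intro sum.cong) (auto simp: algebra_simps simp del: index_mult_mat_vec)
  then show "quad_form M (u - v) = quad_form M u + quad_form M v - 2 * Re ((M *\<^sub>v u) \<bullet>c v)"
    using * by (simp add: quad_form_def)
qed

lemma quad_form_one: "v \<in> carrier_vec n \<Longrightarrow> quad_form (1\<^sub>m n) v = norm_sq v"
  by (simp add: quad_form_def flip: norm_sq_cscalar)

lemma quad_form_congruence:
  assumes A: "A \<in> carrier_mat n n" and X: "X \<in> carrier_mat n k" and v: "v \<in> carrier_vec k"
  shows "quad_form (mat_adjoint X * A * X) v = quad_form A (X *\<^sub>v v)"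
proof -
  have Xv: "X *\<^sub>v v \<in> carrier_vec n" by (rule mult_mat_vec_carrier[OF X v])
  have XA: "mat_adjoint X * A \<in> carrier_mat k n" by (rule mult_carrier_mat[OF mat_adjoint_carrier[OF X] A])
  have "(mat_adjoint X * A * X) *\<^sub>v v = mat_adjoint X *\<^sub>v (A *\<^sub>v (X *\<^sub>v v))"
    using assoc_mult_mat_vec[OF XA X v] assoc_mult_mat_vec[OF mat_adjoint_carrier[OF X] A Xv] by simp
  then show ?thesis unfolding quad_form_def
    using cscalar_prod_adjoint[OF mat_adjoint_carrier[OF X] mult_mat_vec_carrier[OF A Xv] v] by simp
qed

lemma hermitian_congruence:
  fixes A X :: "complex mat"
  assumes A: "A \<in> carrier_mat n n" "mat_adjoint A = A" and X: "X \<in> carrier_mat n k"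
  shows "mat_adjoint X * A * X \<in> carrier_mat k k" "mat_adjoint (mat_adjoint X * A * X) = mat_adjoint X * A * X"
proof -
  note aX = mat_adjoint_carrier[OF X]
  have XA: "mat_adjoint X * A \<in> carrier_mat k n" by (rule mult_carrier_mat[OF aX A(1)])
  show "mat_adjoint X * A * X \<in> carrier_mat k k" by (rule mult_carrier_mat[OF XA X])
  show "mat_adjoint (mat_adjoint X * A * X) = mat_adjoint X * A * X"
    using mat_adjoint_mult[OF XA X] mat_adjoint_mult[OF aX A(1)] assoc_mult_mat[OF aX A(1) X] A(2) by simp
qed

lemma norm_sq_mat_diag:
  assumes "v \<in> carrier_vec n"
  shows "norm_sq (mat_diag n (\<lambda>i. complex_of_real (b i)) *\<^sub>v v) = (\<Sum>i<n. (b i)\<^sup>2 * (cmod (v $ i))\<^sup>2)"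
proof -
  have "mat_diag n (\<lambda>i. complex_of_real (b i)) *\<^sub>v v \<in> carrier_vec n"
    by (rule mult_mat_vec_carrier[OF mat_diag_dim assms])
  then show ?thesis
    by (simp add: norm_sq_sum mat_diag_mult_vec_index[OF assms] norm_mult power_mult_distrib del: index_mult_mat_vec)
qed

lemma norm_sq_mat_diag_le:
  assumes v: "v \<in> carrier_vec n" and b: "\<And>i. i < n \<Longrightarrow> \<bar>b i\<bar> \<le> 1"
  shows "norm_sq (mat_diag n (\<lambda>i. complex_of_real (b i)) *\<^sub>v v) \<le> norm_sq v"
proof -
  have "(b i)\<^sup>2 * (cmod (v $ i))\<^sup>2 \<le> 1 * (cmod (v $ i))\<^sup>2" if "i < n" for i
    using b[OF that] by (intro mult_right_mono) (auto simp: abs_square_le_1)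
  then show ?thesis unfolding norm_sq_mat_diag[OF v] norm_sq_sum[OF v] by (intro sum_mono) auto
qed

text \<open>In an eigenbasis \<open>B\<close> has the entries \<open>(a - m) / r\<close> for the
  eigenvalues \<open>a\<close> of \<open>A\<close>, with \<open>m\<close> the midpoint of the
  spectrum and \<open>r\<close> its half-width, so they lie in [-1, 1]. For \<open>r = 0\<close> the
  choice is \<open>B = 0\<close>; the last clause records it because invariance of a subspace cannot
  then be passed from \<open>A\<close> to \<open>B\<close> by dividing by \<open>r\<close>.\<close>

lemma centered_contraction:
  assumes A: "A \<in> carrier_mat n n" "mat_adjoint A = A" and n: "0 < n"
  obtains B m where "B \<in> carrier_mat n n" "mat_adjoint B = B" "0 \<le> spr A"
    "\<And>v. v \<in> carrier_vec n \<Longrightarrow> A *\<^sub>v v = complex_of_real m \<cdot>\<^sub>v v + complex_of_real (spr A / 2) \<cdot>\<^sub>v (B *\<^sub>v v)"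
    "\<And>v. v \<in> carrier_vec n \<Longrightarrow> norm_sq (B *\<^sub>v v) \<le> norm_sq v"
    "\<And>v. v \<in> carrier_vec n \<Longrightarrow> \<bar>quad_form B v\<bar> \<le> norm_sq v"
    "\<And>v. v \<in> carrier_vec n \<Longrightarrow> spr A = 0 \<Longrightarrow> B *\<^sub>v v = 0\<^sub>v n"
proof -
  let ?a = "\<lambda>i. eigvals A ! i"
  obtain U where U: "U \<in> carrier_mat n n" "mat_adjoint U * U = 1\<^sub>m n"
    and AU: "A = U * mat_diag n (\<lambda>i. complex_of_real (?a i)) * mat_adjoint U"
    using eigvals_diagonalization(1)[OF A] by blast
  note len = eigvals_diagonalization(2)[OF A] and srt = eigvals_diagonalization(3)[OF A]
  have ne: "eigvals A \<noteq> []" using len n by auto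
  have s: "spr A = ?a 0 - ?a (n - 1)" using ne by (simp add: spr_def hd_conv_nth last_conv_nth len)
  define m r where "m = (?a 0 + ?a (n - 1)) / 2" and "r = spr A / 2"
  have s0: "0 \<le> spr A" using srt[of 0 "n - 1"] n by (simp add: s)
  then have r0: "0 \<le> r" by (simp add: r_def)
  define b where "b i = (if r = 0 then 0 else (?a i - m) / r)" for i
  have dev: "\<bar>?a i - m\<bar> \<le> r" if "i < n" for i
  proof -
    have "?a i \<le> ?a 0" "?a (n - 1) \<le> ?a i" using that srt[of 0 i] srt[of i "n - 1"] by auto
    then show ?thesis unfolding m_def r_def s by argo
  qed
  \<comment> \<open>This includes \<open>r = 0\<close>, where \<open>dev\<close> forces
    \<open>?a i = m\<close>.\<close>
  have ab: "?a i = m + r * b i" if "i < n" for i using dev[OF that] by (auto simp: b_def)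
  have b1: "\<bar>b i\<bar> \<le> 1" if "i < n" for i
    using dev[OF that] r0 by (auto simp: b_def divide_le_eq)
  let ?D = "mat_diag n (\<lambda>i. complex_of_real (b i))" and ?E = "mat_diag n (\<lambda>i. complex_of_real (?a i))"
  define B where "B = U * ?D * mat_adjoint U"
  have D: "?D \<in> carrier_mat n n" and E: "?E \<in> carrier_mat n n" by simp_all
  have UD: "U * ?D \<in> carrier_mat n n" by (rule mult_carrier_mat[OF U(1) D])
  note aU = mat_adjoint_carrier[OF U(1)]
  have cB: "B \<in> carrier_mat n n" unfolding B_def by (rule mult_carrier_mat[OF UD aU])
  have hB: "mat_adjoint B = B"
    unfolding B_def using mat_adjoint_mult[OF UD aU] mat_adjoint_mult[OF U(1) D] assoc_mult_mat[OF U(1) D aU] by simp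
  have nU: "norm_sq (mat_adjoint U *\<^sub>v v) = norm_sq v" if "v \<in> carrier_vec n" for v
    using norm_sq_isometry[OF aU _ that] unitary_right[OF U] by simp
  have app: "(U * mat_diag n f * mat_adjoint U) *\<^sub>v v = U *\<^sub>v (mat_diag n f *\<^sub>v (mat_adjoint U *\<^sub>v v))"
    if v: "v \<in> carrier_vec n" for v f
    using assoc_mult_mat_vec[OF mult_carrier_mat[OF U(1) mat_diag_dim] aU v]
      assoc_mult_mat_vec[OF U(1) mat_diag_dim mult_mat_vec_carrier[OF aU v]] by simp
  show ?thesis
  proof (rule that[OF cB hB s0])
    fix v :: "complex vec" assume v: "v \<in> carrier_vec n"
    let ?w = "mat_adjoint U *\<^sub>v v"
    have w: "?w \<in> carrier_vec n" by (rule mult_mat_vec_carrier[OF aU v])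
    have Dw: "?D *\<^sub>v ?w \<in> carrier_vec n" and Ew: "?E *\<^sub>v ?w \<in> carrier_vec n"
      using mult_mat_vec_carrier[OF D w] mult_mat_vec_carrier[OF E w] .
    have "?E *\<^sub>v ?w = complex_of_real m \<cdot>\<^sub>v ?w + complex_of_real r \<cdot>\<^sub>v (?D *\<^sub>v ?w)"
    proof (rule eq_vecI)
      fix i assume "i < dim_vec (complex_of_real m \<cdot>\<^sub>v ?w + complex_of_real r \<cdot>\<^sub>v (?D *\<^sub>v ?w))"
      then have i: "i < n" using Dw by simp
      then show "(?E *\<^sub>v ?w) $ i = (complex_of_real m \<cdot>\<^sub>v ?w + complex_of_real r \<cdot>\<^sub>v (?D *\<^sub>v ?w)) $ i"
        using w Dw carrier_matD[OF U(1)] by (simp add: mat_diag_mult_vec_index[OF w] ab algebra_simps del: index_mult_mat_vec)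
    qed (use Dw Ew in auto)
    then have "A *\<^sub>v v = U *\<^sub>v (complex_of_real m \<cdot>\<^sub>v ?w + complex_of_real r \<cdot>\<^sub>v (?D *\<^sub>v ?w))"
      by (subst AU) (simp only: app[OF v])
    also have "\<dots> = complex_of_real m \<cdot>\<^sub>v (U *\<^sub>v ?w) + complex_of_real r \<cdot>\<^sub>v (U *\<^sub>v (?D *\<^sub>v ?w))"
      using mult_add_distrib_mat_vec[OF U(1), of "complex_of_real m \<cdot>\<^sub>v ?w" "complex_of_real r \<cdot>\<^sub>v (?D *\<^sub>v ?w)"]
        mult_mat_vec[OF U(1) w] mult_mat_vec[OF U(1) Dw] w Dw by simp
    also have "U *\<^sub>v ?w = v"
      using assoc_mult_mat_vec[OF U(1) aU v] unitary_right[OF U] v by simp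
    also have "U *\<^sub>v (?D *\<^sub>v ?w) = B *\<^sub>v v" unfolding B_def by (simp only: app[OF v])
    finally show "A *\<^sub>v v = complex_of_real m \<cdot>\<^sub>v v + complex_of_real (spr A / 2) \<cdot>\<^sub>v (B *\<^sub>v v)"
      unfolding r_def .
    have "norm_sq (B *\<^sub>v v) = norm_sq (?D *\<^sub>v ?w)"
      unfolding B_def app[OF v] by (rule norm_sq_isometry[OF U Dw])
    also have "\<dots> \<le> norm_sq v" using norm_sq_mat_diag_le[OF w b1] nU[OF v] by simp
    finally show "norm_sq (B *\<^sub>v v) \<le> norm_sq v" .
    have "\<bar>quad_form B v\<bar> \<le> (\<Sum>i<n. \<bar>b i * (cmod (?w $ i))\<^sup>2\<bar>)"
      unfolding B_def quad_form_diagonalized[OF U(1) v] by (rule sum_abs)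
    also have "\<dots> \<le> (\<Sum>i<n. (cmod (?w $ i))\<^sup>2)"
      using b1 by (intro sum_mono) (auto simp: abs_mult intro!: mult_left_le_one_le simp del: index_mult_mat_vec)
    also have "\<dots> = norm_sq v" using nU[OF v] norm_sq_sum[OF w] by simp
    finally show "\<bar>quad_form B v\<bar> \<le> norm_sq v" .
    assume "spr A = 0"
    then have "b i = 0" for i by (simp add: b_def r_def)
    then have "?D *\<^sub>v ?w = 0\<^sub>v n"
      using Dw w by (intro eq_vecI) (auto simp: mat_diag_mult_vec_index[OF w] simp del: index_mult_mat_vec)
    then have "B *\<^sub>v v = U *\<^sub>v 0\<^sub>v n" unfolding B_def app[OF v] by simp
    then show "B *\<^sub>v v = 0\<^sub>v n" using U(1) by (simp, intro eq_vecI) (auto simp: scalar_prod_def)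
  qed
qed

text \<open>Bathtub principle: weight capped at 1 per index and at \<open>j\<close> in total is best
  spent on the largest values of \<open>f\<close>, which for nondecreasing \<open>f\<close> come
  last.\<close>

lemma sum_weights_le:
  fixes f w :: "nat \<Rightarrow> real"
  assumes f0: "\<And>i. i < k \<Longrightarrow> 0 \<le> f i" and fm: "\<And>i j. i \<le> j \<Longrightarrow> j < k \<Longrightarrow> f i \<le> f j"
    and w: "\<And>i. i < k \<Longrightarrow> 0 \<le> w i" "\<And>i. i < k \<Longrightarrow> w i \<le> 1" and ws: "(\<Sum>i<k. w i) \<le> j" and "j \<le> k"
  shows "(\<Sum>i<k. f i * w i) \<le> (\<Sum>i\<in>{k - j..<k}. f i)"
proof (cases "k = 0")
  case False
  \<comment> \<open>\<open>t\<close> separates the \<open>j\<close> largest values of \<open>f\<close> from the others.\<close>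
  define t where "t = f (if j = 0 then k - 1 else k - j)"
  have t0: "0 \<le> t" using f0 False by (auto simp: t_def)
  have hi: "t \<le> f i" if "i \<in> {k - j..<k}" for i using that fm by (auto simp: t_def)
  have lo: "f i \<le> t" if "i < k - j" for i using that fm False by (auto simp: t_def)
  have split: "{..<k} = {..<k - j} \<union> {k - j..<k}" using \<open>j \<le> k\<close> by auto
  have "(\<Sum>i<k. f i * w i) = (\<Sum>i<k - j. f i * w i) + (\<Sum>i\<in>{k - j..<k}. f i * w i)"
    unfolding split by (rule sum.union_disjoint) auto
  also have "(\<Sum>i<k - j. f i * w i) \<le> (\<Sum>i<k - j. t * w i)"
    using lo w(1) by (intro sum_mono mult_right_mono) auto
  also have "(\<Sum>i\<in>{k - j..<k}. f i * w i) \<le> (\<Sum>i\<in>{k - j..<k}. f i - t + t * w i)"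
  proof (rule sum_mono)
    fix i assume i: "i \<in> {k - j..<k}"
    then have "0 \<le> (f i - t) * (1 - w i)" using hi w(2) by auto
    then show "f i * w i \<le> f i - t + t * w i" by (simp add: algebra_simps)
  qed
  also have "(\<Sum>i\<in>{k - j..<k}. f i - t + t * w i) = (\<Sum>i\<in>{k - j..<k}. f i) - t * j + (\<Sum>i\<in>{k - j..<k}. t * w i)"
    using \<open>j \<le> k\<close> by (simp add: sum.distrib sum_subtractf)
  also have "(\<Sum>i<k - j. t * w i) + ((\<Sum>i\<in>{k - j..<k}. f i) - t * j + (\<Sum>i\<in>{k - j..<k}. t * w i)) =
    (\<Sum>i\<in>{k - j..<k}. f i) - t * j + t * (\<Sum>i<k. w i)"
    unfolding split by (subst sum.union_disjoint) (auto simp: sum_distrib_left distrib_left)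
  \<comment> \<open>The total weight may stay below \<open>j\<close>; the missing mass is harmless
    because \<open>t\<close> is nonnegative.\<close>
  also have "\<dots> \<le> (\<Sum>i\<in>{k - j..<k}. f i)" using mult_left_mono[OF ws t0] by simp
  finally show ?thesis by simp
qed simp

subsection \<open>Ritz values of aligned bases\<close>

text \<open>\<open>B *\<^sub>v h\<close> is \<open>K y\<close> for \<open>K = B (1 + C) / 2\<close>.
  Pairing it with \<open>(1 - C) y / 2\<close> and using \<open>2 u v <= u^2 + v^2\<close> in every
  coordinate leaves the factor \<open>1 - c p\<close> in front of squared moduli that can serve as
  weights.\<close>

lemma quad_form_diff_contracted_le:
  assumes B: "B \<in> carrier_mat k k" "mat_adjoint B = B" and y: "y \<in> carrier_vec k"
    and c: "\<And>i. i < k \<Longrightarrow> c i \<le> 1"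
  defines "h \<equiv> mat_diag k (\<lambda>i. complex_of_real ((1 + c i) / 2)) *\<^sub>v y"
  shows "\<bar>quad_form B y - quad_form B (mat_diag k (\<lambda>i. complex_of_real (c i)) *\<^sub>v y)\<bar> \<le>
    (\<Sum>p<k. (1 - c p) * ((cmod (y $ p))\<^sup>2 + (cmod ((B *\<^sub>v h) $ p))\<^sup>2))"
proof -
  let ?Cy = "mat_diag k (\<lambda>i. complex_of_real (c i)) *\<^sub>v y"
  \<comment> \<open>\<open>y = h + d\<close> and \<open>C y = h - d\<close>, so polarization turns the difference into \<open>4 Re \<langle>B h, d\<rangle>\<close>.\<close>
  define d where "d = mat_diag k (\<lambda>i. complex_of_real ((1 - c i) / 2)) *\<^sub>v y"
  have Cy: "?Cy \<in> carrier_vec k" and h: "h \<in> carrier_vec k" and d: "d \<in> carrier_vec k"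
    unfolding h_def d_def using mult_mat_vec_carrier[OF mat_diag_dim y] by auto
  have Bh: "B *\<^sub>v h \<in> carrier_vec k" by (rule mult_mat_vec_carrier[OF B(1) h])
  have hi: "h $ p = complex_of_real ((1 + c p) / 2) * y $ p" and di: "d $ p = complex_of_real ((1 - c p) / 2) * y $ p"
    and Ci: "?Cy $ p = complex_of_real (c p) * y $ p" if "p < k" for p
    unfolding h_def d_def using mat_diag_mult_vec_index[OF y that] by blast+
  have hd: "y = h + d" "?Cy = h - d"
    using h d Cy y by (auto simp: hi di Ci field_simps simp del: index_mult_mat_vec)
  have "quad_form B (h + d) - quad_form B (h - d) = 4 * Re ((B *\<^sub>v h) \<bullet>c d)"
    unfolding quad_form_polarization[OF B h d] by simp
  then have "quad_form B y - quad_form B ?Cy = 4 * Re ((B *\<^sub>v h) \<bullet>c d)"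
    using hd by simp
  also have "\<dots> = (\<Sum>p<k. 4 * Re ((B *\<^sub>v h) $ p * cnj (d $ p)))"
    by (simp only: cscalar_prod_sum[OF d] Re_sum sum_distrib_left)
  finally have "\<bar>quad_form B y - quad_form B ?Cy\<bar> \<le> (\<Sum>p<k. \<bar>4 * Re ((B *\<^sub>v h) $ p * cnj (d $ p))\<bar>)"
    by (simp only: sum_abs)
  also have "\<dots> \<le> (\<Sum>p<k. (1 - c p) * ((cmod (y $ p))\<^sup>2 + (cmod ((B *\<^sub>v h) $ p))\<^sup>2))"
  proof (rule sum_mono)
    fix p assume "p \<in> {..<k}"
    then have p: "p < k" by simp
    let ?u = "cmod (y $ p)" and ?v = "cmod ((B *\<^sub>v h) $ p)"
    have "\<bar>Re ((B *\<^sub>v h) $ p * cnj (d $ p))\<bar> \<le> cmod ((B *\<^sub>v h) $ p * cnj (d $ p))" by (rule abs_Re_le_cmod)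
    also have "\<dots> = ?v * ((1 - c p) / 2 * ?u)"
      unfolding di[OF p] norm_mult complex_mod_cnj norm_of_real using c[OF p] by simp
    finally have le: "\<bar>Re ((B *\<^sub>v h) $ p * cnj (d $ p))\<bar> \<le> ?v * ((1 - c p) / 2 * ?u)" .
    have "\<bar>4 * Re ((B *\<^sub>v h) $ p * cnj (d $ p))\<bar> = 4 * \<bar>Re ((B *\<^sub>v h) $ p * cnj (d $ p))\<bar>"
      by (simp only: abs_mult abs_numeral)
    also have "\<dots> \<le> 4 * (?v * ((1 - c p) / 2 * ?u))" using le by (intro mult_left_mono) simp_all
    also have "\<dots> = (1 - c p) * (2 * ?u * ?v)" by (simp only: times_divide_eq_left times_divide_eq_right) simp
    also have "\<dots> \<le> (1 - c p) * (?u\<^sup>2 + ?v\<^sup>2)"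
      using c[OF p] sum_squares_bound[of ?u ?v] by (intro mult_left_mono) auto
    finally show "\<bar>4 * Re ((B *\<^sub>v h) $ p * cnj (d $ p))\<bar> \<le> (1 - c p) * (?u\<^sup>2 + ?v\<^sup>2)" .
  qed
  finally show ?thesis .
qed

lemma norm_sq_unit_vec: "p < k \<Longrightarrow> norm_sq (unit_vec k p) = 1"
proof -
  assume "p < k"
  have "norm_sq (unit_vec k p) = (\<Sum>i<k. if i = p then 1 else 0)"
    unfolding norm_sq_sum[OF unit_vec_carrier] by (intro sum.cong) (auto simp: unit_vec_def)
  then show ?thesis using \<open>p < k\<close> by simp
qed

lemma norm_sq_row:
  assumes R: "R \<in> carrier_mat n k" and p: "p < n"
  shows "(\<Sum>l<k. (cmod (R $$ (p, l)))\<^sup>2) = norm_sq (mat_adjoint R *\<^sub>v unit_vec n p)"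
proof -
  have c: "mat_adjoint R *\<^sub>v unit_vec n p \<in> carrier_vec k"
    by (rule mult_mat_vec_carrier[OF mat_adjoint_carrier[OF R] unit_vec_carrier])
  have "(mat_adjoint R *\<^sub>v unit_vec n p) $ l = cnj (R $$ (p, l))" if "l < k" for l
    using R p that by simp
  then show ?thesis unfolding norm_sq_sum[OF c] by (intro sum.cong) (auto simp del: index_mult_mat_vec)
qed

text \<open>The squared moduli of the entries of \<open>K V\<close> form a doubly substochastic
  matrix: rows are controlled by the adjoint of \<open>K\<close>, columns by \<open>K\<close>
  itself. Restricting to the columns in \<open>J\<close> keeps the row bound and leaves mass at most
  one per column.\<close>

lemma weights_of_contraction:
  assumes V: "V \<in> carrier_mat k k" "mat_adjoint V * V = 1\<^sub>m k" and K: "K \<in> carrier_mat k k"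
    and con: "\<And>v. v \<in> carrier_vec k \<Longrightarrow> norm_sq (K *\<^sub>v v) \<le> norm_sq v"
    and con': "\<And>v. v \<in> carrier_vec k \<Longrightarrow> norm_sq (mat_adjoint K *\<^sub>v v) \<le> norm_sq v"
    and J: "J \<subseteq> {..<k}"
  shows "p < k \<Longrightarrow> (\<Sum>l\<in>J. (cmod ((K *\<^sub>v col V l) $ p))\<^sup>2) \<le> 1"
    and "(\<Sum>p<k. \<Sum>l\<in>J. (cmod ((K *\<^sub>v col V l) $ p))\<^sup>2) \<le> card J"
proof -
  have KV: "K * V \<in> carrier_mat k k" by (rule mult_carrier_mat[OF K V(1)])
  have nc: "norm_sq (col V l) = 1" if l: "l < k" for l
  proof -
    have "complex_of_real (norm_sq (col V l)) = (\<Sum>a<k. cnj (V $$ (a, l)) * V $$ (a, l))"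
      using l V(1) by (simp add: norm_sq_cscalar cscalar_prod_sum[of _ k] mult.commute)
    also have "\<dots> = 1" using V(2)[unfolded isometry_index[OF V(1)]] l by simp
    finally show ?thesis by (metis of_real_eq_1_iff)
  qed
  { assume p: "p < k"
    have "(\<Sum>l\<in>J. (cmod ((K *\<^sub>v col V l) $ p))\<^sup>2) \<le> (\<Sum>l<k. (cmod ((K *\<^sub>v col V l) $ p))\<^sup>2)"
      using J by (intro sum_mono2) auto
    also have "\<dots> = (\<Sum>l<k. (cmod ((K * V) $$ (p, l)))\<^sup>2)"
      using K V(1) p by (intro sum.cong) auto
    \<comment> \<open>Up to conjugation, row \<open>p\<close> of \<open>K V\<close> is
      \<open>V\<^sup>H K\<^sup>H\<close> applied to a unit vector; this is where the adjoint must be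
      a contraction.\<close>
    also have "\<dots> = norm_sq (mat_adjoint (K * V) *\<^sub>v unit_vec k p)" by (rule norm_sq_row[OF KV p])
    also have "mat_adjoint (K * V) *\<^sub>v unit_vec k p = mat_adjoint V *\<^sub>v (mat_adjoint K *\<^sub>v unit_vec k p)"
      unfolding mat_adjoint_mult[OF K V(1)]
      by (rule assoc_mult_mat_vec[OF mat_adjoint_carrier[OF V(1)] mat_adjoint_carrier[OF K] unit_vec_carrier])
    also have "norm_sq \<dots> = norm_sq (mat_adjoint K *\<^sub>v unit_vec k p)"
      using unitary_right[OF V]
      by (intro norm_sq_isometry[OF mat_adjoint_carrier[OF V(1)]] mult_mat_vec_carrier[OF mat_adjoint_carrier[OF K] unit_vec_carrier]) simp
    also have "\<dots> \<le> 1" using con'[OF unit_vec_carrier, of p] norm_sq_unit_vec[OF p] by simp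
    finally show "(\<Sum>l\<in>J. (cmod ((K *\<^sub>v col V l) $ p))\<^sup>2) \<le> 1" . }
  have "(\<Sum>p<k. \<Sum>l\<in>J. (cmod ((K *\<^sub>v col V l) $ p))\<^sup>2) = (\<Sum>l\<in>J. \<Sum>p<k. (cmod ((K *\<^sub>v col V l) $ p))\<^sup>2)"
    by (rule sum.swap)
  also have "\<dots> \<le> (\<Sum>l\<in>J. 1)"
  proof (rule sum_mono)
    fix l assume "l \<in> J"
    then have l: "l < k" using J by auto
    have cl: "col V l \<in> carrier_vec k" using V(1) l by auto
    show "(\<Sum>p<k. (cmod ((K *\<^sub>v col V l) $ p))\<^sup>2) \<le> 1"
      using con[OF cl] nc[OF l] norm_sq_sum[OF mult_mat_vec_carrier[OF K cl]] by simp
  qed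
  finally show "(\<Sum>p<k. \<Sum>l\<in>J. (cmod ((K *\<^sub>v col V l) $ p))\<^sup>2) \<le> card J" by simp
qed

text \<open>The whole estimate, for bases rotated so that \<open>X\<^sup>H Y\<close> is diagonal. As
  the cosines are nonincreasing, the largest angles have the last \<open>card I\<close> indices. The
  set \<open>I\<close> is arbitrary because the largest gaps on the left may occur anywhere. The
  bound \<open>c p \<le> 1\<close> falls out of the residual computation and is exported for
  \<open>arccos\<close>.\<close>

lemma ritz_values_aligned:
  assumes A: "A \<in> carrier_mat n n" "mat_adjoint A = A"
    and X: "X \<in> carrier_mat n k" "mat_adjoint X * X = 1\<^sub>m k"
    and Y: "Y \<in> carrier_mat n k" "mat_adjoint Y * Y = 1\<^sub>m k"
    and XY: "mat_adjoint X * Y = mat_diag k (\<lambda>i. complex_of_real (c i))"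
    and c: "\<And>i. i < k \<Longrightarrow> 0 \<le> c i" "\<And>i j. i \<le> j \<Longrightarrow> j < k \<Longrightarrow> c j \<le> c i"
    and inv: "\<And>w. w \<in> carrier_vec k \<Longrightarrow> \<exists>u \<in> carrier_vec k. A *\<^sub>v (X *\<^sub>v w) = X *\<^sub>v u"
    and I: "I \<subseteq> {..<k}" and n: "0 < n"
  shows "(\<Sum>i\<in>I. \<bar>eigvals (mat_adjoint X * A * X) ! i - eigvals (mat_adjoint Y * A * Y) ! i\<bar>) \<le>
      (\<Sum>p\<in>{k - card I..<k}. spr A * (1 - c p + (1 - (c p)\<^sup>2) / 2))"
    and "p < k \<Longrightarrow> c p \<le> 1"
proof -
  obtain B m where B: "B \<in> carrier_mat n n" "mat_adjoint B = B" and s0: "0 \<le> spr A"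
    and AB: "\<And>v. v \<in> carrier_vec n \<Longrightarrow> A *\<^sub>v v = complex_of_real m \<cdot>\<^sub>v v + complex_of_real (spr A / 2) \<cdot>\<^sub>v (B *\<^sub>v v)"
    and Bn: "\<And>v. v \<in> carrier_vec n \<Longrightarrow> norm_sq (B *\<^sub>v v) \<le> norm_sq v"
    and Bq: "\<And>v. v \<in> carrier_vec n \<Longrightarrow> \<bar>quad_form B v\<bar> \<le> norm_sq v"
    and B0: "\<And>v. v \<in> carrier_vec n \<Longrightarrow> spr A = 0 \<Longrightarrow> B *\<^sub>v v = 0\<^sub>v n"
    using centered_contraction[OF A n] by metis
  define r where "r = spr A / 2"
  have r0: "0 \<le> r" using s0 by (simp add: r_def)
  note Xc = mult_mat_vec_carrier[OF X(1)] and Yc = mult_mat_vec_carrier[OF Y(1)]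
  note aX = mat_adjoint_carrier[OF X(1)]
  note Bc = mult_mat_vec_carrier[OF B(1)]
  let ?C = "mat_diag k (\<lambda>i. complex_of_real (c i))"
  note Cc = mult_mat_vec_carrier[OF mat_diag_dim, of _ k "\<lambda>i. complex_of_real (c i)"]
  have XX: "mat_adjoint X *\<^sub>v (X *\<^sub>v u) = u" if "u \<in> carrier_vec k" for u
    using assoc_mult_mat_vec[OF aX X(1) that] X(2) that by simp
  define B1 where "B1 = mat_adjoint X * B * X"
  note B1 = hermitian_congruence[OF B X(1), folded B1_def]
  have B1v: "B1 *\<^sub>v w = mat_adjoint X *\<^sub>v (B *\<^sub>v (X *\<^sub>v w))" if w: "w \<in> carrier_vec k" for w
    unfolding B1_def
    using assoc_mult_mat_vec[OF mult_carrier_mat[OF aX B(1)] X(1) w] assoc_mult_mat_vec[OF aX B(1) Xc[OF w]] by simp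
  \<comment> \<open>Invariance passes from \<open>A\<close> to \<open>B\<close>, which acts as
    \<open>(A - m) / r\<close> for nonzero \<open>r\<close> and as zero otherwise. Since
    \<open>X\<close> is an isometry, the coordinates of the image can only be
    \<open>B1 *\<^sub>v w\<close>.\<close>
  have BX: "B *\<^sub>v (X *\<^sub>v w) = X *\<^sub>v (B1 *\<^sub>v w)" if w: "w \<in> carrier_vec k" for w
  proof -
    have "\<exists>u \<in> carrier_vec k. B *\<^sub>v (X *\<^sub>v w) = X *\<^sub>v u"
    proof (cases "spr A = 0")
      case True
      have "X *\<^sub>v 0\<^sub>v k = 0\<^sub>v n" using X(1) by (intro eq_vecI) (auto simp: scalar_prod_def)
      then show ?thesis using B0[OF Xc[OF w] True] by (intro bexI[of _ "0\<^sub>v k"]) auto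
    next
      case False
      then have r: "r \<noteq> 0" by (simp add: r_def)
      obtain u where u: "u \<in> carrier_vec k" "A *\<^sub>v (X *\<^sub>v w) = X *\<^sub>v u" using inv[OF w] by blast
      let ?u = "complex_of_real (1 / r) \<cdot>\<^sub>v (u - complex_of_real m \<cdot>\<^sub>v w)"
      have "X *\<^sub>v ?u = complex_of_real (1 / r) \<cdot>\<^sub>v (X *\<^sub>v u - complex_of_real m \<cdot>\<^sub>v (X *\<^sub>v w))"
        using mult_mat_vec[OF X(1), of "u - complex_of_real m \<cdot>\<^sub>v w"] mult_minus_distrib_mat_vec[OF X(1) u(1), of "complex_of_real m \<cdot>\<^sub>v w"]
          mult_mat_vec[OF X(1) w] u w by simp
      also have "\<dots> = B *\<^sub>v (X *\<^sub>v w)"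
        unfolding u(2)[symmetric] AB[OF Xc[OF w]] r_def[symmetric]
        using r carrier_matD[OF X(1)] carrier_matD[OF B(1)] by (intro eq_vecI) (auto simp: field_simps simp del: index_mult_mat_vec)
      finally show ?thesis using u w by (intro bexI[of _ ?u]) auto
    qed
    then obtain u where u: "u \<in> carrier_vec k" "B *\<^sub>v (X *\<^sub>v w) = X *\<^sub>v u" by blast
    then show ?thesis using B1v[OF w] XX[OF u(1)] by simp
  qed
  have B1n: "norm_sq (B1 *\<^sub>v w) \<le> norm_sq w" if w: "w \<in> carrier_vec k" for w
    using Bn[OF Xc[OF w]] norm_sq_isometry[OF X w] norm_sq_isometry[OF X mult_mat_vec_carrier[OF B1(1) w]] BX[OF w] by simp
  define Z where "Z y = Y *\<^sub>v y - X *\<^sub>v (?C *\<^sub>v y)" for y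
  have Zc: "Z y \<in> carrier_vec n" if "y \<in> carrier_vec k" for y
    unfolding Z_def using Xc[OF Cc[OF that]] Yc[OF that] by simp
  have YZ: "Y *\<^sub>v y = X *\<^sub>v (?C *\<^sub>v y) + Z y" if "y \<in> carrier_vec k" for y
    unfolding Z_def using carrier_matD[OF X(1)] carrier_matD[OF Y(1)] by (intro eq_vecI) (auto simp del: index_mult_mat_vec)
  have XZ: "(X *\<^sub>v u) \<bullet>c Z y = 0" if u: "u \<in> carrier_vec k" and y: "y \<in> carrier_vec k" for u y
  proof -
    have "mat_adjoint X *\<^sub>v Z y = mat_adjoint X *\<^sub>v (Y *\<^sub>v y) - mat_adjoint X *\<^sub>v (X *\<^sub>v (?C *\<^sub>v y))"
      unfolding Z_def by (rule mult_minus_distrib_mat_vec[OF aX Yc[OF y] Xc[OF Cc[OF y]]])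
    also have "\<dots> = 0\<^sub>v k"
      using XX[OF Cc[OF y]] assoc_mult_mat_vec[OF aX Y(1) y] XY Cc[OF y] by simp
    finally show ?thesis using cscalar_prod_adjoint[OF X(1) u Zc[OF y]] u by simp
  qed
  \<comment> \<open>Pythagoras: \<open>Y y\<close> is as long as \<open>y\<close>, its component in
    the column space of \<open>X\<close> is \<open>X C y\<close>, and the residual is weighted by
    the squared sines.\<close>
  have nZ: "norm_sq (Z y) = (\<Sum>p<k. (1 - (c p)\<^sup>2) * (cmod (y $ p))\<^sup>2)" if y: "y \<in> carrier_vec k" for y
  proof -
    have "norm_sq (Y *\<^sub>v y) = norm_sq (X *\<^sub>v (?C *\<^sub>v y)) + norm_sq (Z y)"
      using quad_form_polarization(1)[of "1\<^sub>m n" n, OF _ _ Xc[OF Cc[OF y]] Zc[OF y]] YZ[OF y] XZ[OF Cc[OF y] y]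
        Xc[OF Cc[OF y]] Zc[OF y] by (simp add: quad_form_one)
    then show ?thesis
      unfolding norm_sq_isometry[OF Y y] norm_sq_isometry[OF X Cc[OF y]] norm_sq_mat_diag[OF y] norm_sq_sum[OF y]
      by (simp add: left_diff_distrib sum_subtractf)
  qed
  \<comment> \<open>A cosine above 1 would make the squared length of \<open>Z\<close> at a unit
    vector negative.\<close>
  have c1: "c p \<le> 1" if p: "p < k" for p
  proof -
    have "norm_sq (Z (unit_vec k p)) = (\<Sum>i<k. if i = p then 1 - (c p)\<^sup>2 else 0)"
      unfolding nZ[OF unit_vec_carrier] by (intro sum.cong) (auto simp: unit_vec_def)
    also have "\<dots> = 1 - (c p)\<^sup>2" using p by simp
    finally have "(c p)\<^sup>2 \<le> 1" using norm_sq_nonneg[of "Z (unit_vec k p)"] by simp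
    then show ?thesis using c(1)[OF p] by (simp add: power2_le_iff_abs_le abs_square_le_1)
  qed
  then show "p < k \<Longrightarrow> c p \<le> 1" .
  let ?M = "mat_adjoint X * A * X" and ?N = "mat_adjoint Y * A * Y"
  let ?T = "mat_diag k (\<lambda>i. complex_of_real ((1 + c i) / 2))"
  define K where "K = B1 * ?T"
  have T: "?T \<in> carrier_mat k k" by simp
  have K: "K \<in> carrier_mat k k" unfolding K_def by (rule mult_carrier_mat[OF B1(1) T])
  have Kv: "K *\<^sub>v v = B1 *\<^sub>v (?T *\<^sub>v v)" if "v \<in> carrier_vec k" for v
    unfolding K_def by (rule assoc_mult_mat_vec[OF B1(1) T that])
  \<comment> \<open>Each \<open>(1 + c i) / 2\<close> is the mean of 1 and a number in [0, 1], so
    \<open>K\<close> inherits the contraction property of \<open>B1\<close> on both sides.\<close>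
  have Tn: "norm_sq (?T *\<^sub>v v) \<le> norm_sq v" if "v \<in> carrier_vec k" for v
    using c(1) c1 by (intro norm_sq_mat_diag_le[OF that]) (auto simp: abs_le_iff)
  have con: "norm_sq (K *\<^sub>v v) \<le> norm_sq v" if v: "v \<in> carrier_vec k" for v
    unfolding Kv[OF v] using B1n[OF mult_mat_vec_carrier[OF T v]] Tn[OF v] by linarith
  have con': "norm_sq (mat_adjoint K *\<^sub>v v) \<le> norm_sq v" if v: "v \<in> carrier_vec k" for v
  proof -
    have "mat_adjoint K = ?T * B1" unfolding K_def mat_adjoint_mult[OF B1(1) T] B1(2) mat_adjoint_diag_of_real ..
    then have "mat_adjoint K *\<^sub>v v = ?T *\<^sub>v (B1 *\<^sub>v v)" using assoc_mult_mat_vec[OF T B1(1) v] by simp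
    then show ?thesis using Tn[OF mult_mat_vec_carrier[OF B1(1) v]] B1n[OF v] by simp
  qed
  have qA: "quad_form A v = m * norm_sq v + r * quad_form B v" if v: "v \<in> carrier_vec n" for v
  proof -
    have "(A *\<^sub>v v) \<bullet>c v = complex_of_real m * (v \<bullet>c v) + complex_of_real r * ((B *\<^sub>v v) \<bullet>c v)"
      unfolding AB[OF v] r_def[symmetric] cscalar_prod_sum[OF v] sum_distrib_left sum.distrib[symmetric]
      using v carrier_matD[OF B(1)] by (intro sum.cong) (auto simp: algebra_simps simp del: index_mult_mat_vec)
    then show ?thesis unfolding quad_form_def norm_sq_cscalar[symmetric] by simp
  qed
  have main: "\<bar>quad_form ?M y - quad_form ?N y\<bar> \<le>
    r * (\<Sum>p<k. (1 - c p) * (cmod (y $ p))\<^sup>2 + (1 - c p) * (cmod ((K *\<^sub>v y) $ p))\<^sup>2 + (1 - (c p)\<^sup>2) * (cmod (y $ p))\<^sup>2)"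
    if y: "y \<in> carrier_vec k" for y
  proof -
    \<comment> \<open>The multiple \<open>m\<close> of the identity cancels because
      \<open>X y\<close> and \<open>Y y\<close> have the same length.\<close>
    have "quad_form ?M y - quad_form ?N y = r * (quad_form B (X *\<^sub>v y) - quad_form B (Y *\<^sub>v y))"
      unfolding quad_form_congruence[OF A(1) X(1) y] quad_form_congruence[OF A(1) Y(1) y] qA[OF Xc[OF y]] qA[OF Yc[OF y]]
        norm_sq_isometry[OF X y] norm_sq_isometry[OF Y y] by (simp add: algebra_simps)
    also have "quad_form B (Y *\<^sub>v y) = quad_form B (X *\<^sub>v (?C *\<^sub>v y)) + quad_form B (Z y)"
      unfolding YZ[OF y] quad_form_polarization(1)[OF B Xc[OF Cc[OF y]] Zc[OF y]] BX[OF Cc[OF y]]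
        XZ[OF mult_mat_vec_carrier[OF B1(1) Cc[OF y]] y] by simp
    also have "quad_form B (X *\<^sub>v y) - (quad_form B (X *\<^sub>v (?C *\<^sub>v y)) + quad_form B (Z y)) =
      (quad_form B1 y - quad_form B1 (?C *\<^sub>v y)) - quad_form B (Z y)"
      unfolding B1_def quad_form_congruence[OF B(1) X(1) y] quad_form_congruence[OF B(1) X(1) Cc[OF y]] by simp
    finally have "\<bar>quad_form ?M y - quad_form ?N y\<bar> =
      r * \<bar>(quad_form B1 y - quad_form B1 (?C *\<^sub>v y)) - quad_form B (Z y)\<bar>"
      using r0 by (simp add: abs_mult)
    also have "\<dots> \<le> r * ((\<Sum>p<k. (1 - c p) * ((cmod (y $ p))\<^sup>2 + (cmod ((K *\<^sub>v y) $ p))\<^sup>2)) +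
        (\<Sum>p<k. (1 - (c p)\<^sup>2) * (cmod (y $ p))\<^sup>2))"
      using quad_form_diff_contracted_le[OF B1 y, of c, OF c1] Bq[OF Zc[OF y]]
      unfolding nZ[OF y] Kv[OF y] by (intro mult_left_mono[OF _ r0]) linarith
    finally show ?thesis by (simp only: sum.distrib[symmetric] distrib_left)
  qed
  obtain V J where V: "V \<in> carrier_mat k k" "mat_adjoint V * V = 1\<^sub>m k" and J: "J \<subseteq> {..<k}" "card J = card I"
    and le: "(\<Sum>i\<in>I. \<bar>eigvals ?M ! i - eigvals ?N ! i\<bar>) \<le> (\<Sum>l\<in>J. \<bar>quad_form ?M (col V l) - quad_form ?N (col V l)\<bar>)"
    using sum_abs_eigvals_diff_le[OF hermitian_congruence[OF A X(1)] hermitian_congruence[OF A Y(1)] I] by blast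
  define w1 where "w1 p = (\<Sum>l\<in>J. (cmod (col V l $ p))\<^sup>2)" for p
  define w2 where "w2 p = (\<Sum>l\<in>J. (cmod ((K *\<^sub>v col V l) $ p))\<^sup>2)" for p
  have vl: "col V l \<in> carrier_vec k" if "l \<in> J" for l using V(1) J(1) that by auto
  have jk: "card I \<le> k" using card_mono[OF _ I] by simp
  have w2: "0 \<le> w2 p" "w2 p \<le> 1" "(\<Sum>p<k. w2 p) \<le> card I" if "p < k" for p
    using weights_of_contraction[OF V K con con' J(1)] that J(2) by (auto simp: w2_def sum_nonneg simp del: index_mult_mat_vec)
  \<comment> \<open>The plain coordinates are the case of the identity as contraction.\<close>
  have w1eq: "w1 p = (\<Sum>l\<in>J. (cmod ((1\<^sub>m k *\<^sub>v col V l) $ p))\<^sup>2)" for p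
    unfolding w1_def by (intro sum.cong) (simp_all add: one_mult_mat_vec[OF vl] del: index_mult_mat_vec)
  have w1: "0 \<le> w1 p" "w1 p \<le> 1" "(\<Sum>p<k. w1 p) \<le> card I" if "p < k" for p
    using weights_of_contraction[OF V one_carrier_mat _ _ J(1)] that J(2)
    unfolding w1eq by (auto simp: sum_nonneg simp del: index_mult_mat_vec)
  \<comment> \<open>An index \<open>p < k\<close> to instantiate \<open>w1(3)\<close> and
    \<open>w2(3)\<close> exists only for positive \<open>k\<close>; for \<open>k = 0\<close> the
    sums are empty.\<close>
  have w1s: "(\<Sum>p<k. w1 p) \<le> card I" and w2s: "(\<Sum>p<k. w2 p) \<le> card I"
    using w1(3) w2(3) by (cases "k = 0"; force)+
  have sq: "(c p)\<^sup>2 \<le> 1" if "p < k" for p using c(1)[OF that] c1[OF that] by (simp add: power_le_one)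
  have "(\<Sum>l\<in>J. \<bar>quad_form ?M (col V l) - quad_form ?N (col V l)\<bar>) \<le>
    (\<Sum>l\<in>J. r * (\<Sum>p<k. (1 - c p) * (cmod (col V l $ p))\<^sup>2 + (1 - c p) * (cmod ((K *\<^sub>v col V l) $ p))\<^sup>2 + (1 - (c p)\<^sup>2) * (cmod (col V l $ p))\<^sup>2))"
    by (intro sum_mono main vl)
  also have "\<dots> = r * ((\<Sum>p<k. (1 - c p) * w1 p) + (\<Sum>p<k. (1 - c p) * w2 p) + (\<Sum>p<k. (1 - (c p)\<^sup>2) * w1 p))"
    unfolding sum_distrib_left[symmetric] w1_def w2_def
    by (subst sum.swap) (simp only: sum.distrib sum_distrib_left)
  \<comment> \<open>\<open>sum_weights_le\<close> is applied to \<open>1 - c\<close> with both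
    weight families and to \<open>1 - c^2\<close> with the first; both functions increase with the
    index, so one range of indices serves all three sums.\<close>
  also have "\<dots> \<le> r * ((\<Sum>p\<in>{k - card I..<k}. 1 - c p) + (\<Sum>p\<in>{k - card I..<k}. 1 - c p) + (\<Sum>p\<in>{k - card I..<k}. 1 - (c p)\<^sup>2))"
    using w1 w2 c c1 sq
    by (intro mult_left_mono[OF _ r0] add_mono sum_weights_le[OF _ _ _ _ w1s jk] sum_weights_le[OF _ _ _ _ w2s jk])
      (auto intro!: power_mono)
  also have "\<dots> = (\<Sum>p\<in>{k - card I..<k}. spr A * (1 - c p + (1 - (c p)\<^sup>2) / 2))"
    unfolding sum.distrib[symmetric] sum_distrib_left by (intro sum.cong) (auto simp: r_def field_simps)
  finally show "(\<Sum>i\<in>I. \<bar>eigvals ?M ! i - eigvals ?N ! i\<bar>) \<le>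
      (\<Sum>p\<in>{k - card I..<k}. spr A * (1 - c p + (1 - (c p)\<^sup>2) / 2))" using le by simp
qed

subsection \<open>Weak submajorization of Ritz values\<close>

text \<open>\<open>eigvals\<close> depends only on the characteristic polynomial and the number of
  rows, which similarity keeps. Rotating a basis inside its subspace therefore leaves the Ritz
  values alone.\<close>

lemma eigvals_unitary_conjugate:
  assumes M: "M \<in> carrier_mat k k" and U: "U \<in> carrier_mat k k" "mat_adjoint U * U = 1\<^sub>m k"
  shows "eigvals (mat_adjoint U * M * U) = eigvals M"
proof -
  note aU = mat_adjoint_carrier[OF U(1)]
  have c: "mat_adjoint U * M * U \<in> carrier_mat k k" by (intro mult_carrier_mat[OF mult_carrier_mat[OF aU M] U(1)])
  have "similar_mat_wit (mat_adjoint U * M * U) M (mat_adjoint U) U"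
    by (rule similar_mat_witI[OF U(2) unitary_right[OF U] refl c M aU U(1)])
  then have "char_poly (mat_adjoint U * M * U) = char_poly M"
    by (intro char_poly_similar) (auto simp: similar_mat_def)
  then show ?thesis using M carrier_matD[OF U(1)] by (simp add: eigvals_def)
qed

text \<open>The adjoint of a singular value decomposition is one with \<open>U\<close> and
  \<open>V\<close> exchanged. This makes the principal angles symmetric in the two
  subspaces.\<close>

lemma sing_vals_adjoint:
  assumes G: "G \<in> carrier_mat k k"
  shows "sing_vals (mat_adjoint G) = sing_vals G"
proof -
  obtain U V c where U: "U \<in> carrier_mat k k" "mat_adjoint U * U = 1\<^sub>m k"
    and V: "V \<in> carrier_mat k k" "mat_adjoint V * V = 1\<^sub>m k"
    and GU: "G = U * mat_diag k (\<lambda>i. complex_of_real (c i)) * mat_adjoint V"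
    and c: "\<forall>i<k. 0 \<le> c i" "\<forall>i j. i \<le> j \<longrightarrow> j < k \<longrightarrow> c j \<le> c i"
    by (rule singular_value_decomposition[OF G])
  let ?C = "mat_diag k (\<lambda>i. complex_of_real (c i))"
  have C: "?C \<in> carrier_mat k k" by simp
  have "mat_adjoint G = V * (?C * mat_adjoint U)"
    unfolding GU using mat_adjoint_mult[OF mult_carrier_mat[OF U(1) C] mat_adjoint_carrier[OF V(1)]]
      mat_adjoint_mult[OF U(1) C] by simp
  also have "\<dots> = V * ?C * mat_adjoint U" by (rule assoc_mult_mat[symmetric, OF V(1) C mat_adjoint_carrier[OF U(1)]])
  finally have "sing_vals (mat_adjoint G) = map c [0..<k]" using c by (intro sing_vals_eq[OF V U]) auto
  moreover have "sing_vals G = map c [0..<k]" using c by (intro sing_vals_eq[OF U V GU]) auto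
  ultimately show ?thesis by simp
qed

text \<open>Translates the sorted prefixes of \<open>weak_submaj\<close> into index sets, the form
  in which the eigenvalue bounds are available.\<close>

lemma sum_list_take_sort_desc:
  assumes "j \<le> length xs"
  shows "\<exists>I \<subseteq> {..<length xs}. card I = j \<and> sum_list (take j (sort_desc xs)) = (\<Sum>i\<in>I. xs ! i)"
proof -
  have "mset (sort_desc xs) = mset xs" by (simp add: sort_desc_def)
  then obtain p where p: "p permutes {..<length xs}" "permute_list p xs = sort_desc xs"
    by (rule mset_eq_permutation)
  have inj: "inj_on p {..<j}" using permutes_inj[OF p(1)] by (rule inj_on_subset) simp
  have "sum_list (take j (sort_desc xs)) = (\<Sum>i<j. take j (sort_desc xs) ! i)"
    using assms by (simp add: sum_list_sum_nth sort_desc_def atLeast0LessThan)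
  also have "\<dots> = (\<Sum>i<j. xs ! p i)"
    using assms by (intro sum.cong) (auto simp: p(2)[symmetric] permute_list_nth[OF p(1)])
  also have "\<dots> = (\<Sum>i\<in>p ` {..<j}. xs ! i)" using inj by (simp add: sum.reindex)
  finally have "sum_list (take j (sort_desc xs)) = (\<Sum>i\<in>p ` {..<j}. xs ! i)" .
  moreover have "p ` {..<j} \<subseteq> {..<length xs}"
    using permutes_image[OF p(1)] assms by (metis image_mono lessThan_subset_iff)
  ultimately show ?thesis using inj by (intro exI[of _ "p ` {..<j}"]) (simp add: card_image)
qed

text \<open>The reversal is the one in \<open>sing_vals_up\<close>. For nondecreasing
  \<open>g\<close> the reversed list is already in descending order, so its prefix consists of the
  last values of \<open>g\<close>.\<close>

lemma sum_list_take_sort_desc_rev: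
  assumes "\<And>i j. i \<le> j \<Longrightarrow> j < k \<Longrightarrow> g i \<le> g j" and "j \<le> k"
  shows "sum_list (take j (sort_desc (rev (map g [0..<k])))) = (\<Sum>p\<in>{k - j..<k}. g p)"
proof -
  have "sort (rev (map g [0..<k])) = map g [0..<k]"
    using assms(1) by (intro properties_for_sort) (auto simp: sorted_iff_nth_mono)
  then have "take j (sort_desc (rev (map g [0..<k]))) = rev (map g [k - j..<k])"
    using \<open>j \<le> k\<close> by (simp add: sort_desc_def take_rev drop_map)
  then show ?thesis by (simp add: interv_sum_list_conv_sum_set_nat)
qed

text \<open>If \<open>U C V\<^sup>H\<close> is a singular value decomposition of
  \<open>X\<^sup>H Y\<close>, the bases \<open>X U\<close> and \<open>Y V\<close> are aligned.
  Passing to them changes neither the Ritz values nor the column spaces.\<close>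

lemma ritz_values_invariant:
  assumes A: "A \<in> carrier_mat n n" "mat_adjoint A = A"
    and X: "X \<in> carrier_mat n k" "mat_adjoint X * X = 1\<^sub>m k"
    and Y: "Y \<in> carrier_mat n k" "mat_adjoint Y * Y = 1\<^sub>m k"
    and inv: "invariant_subspace A (col_space X)"
  shows "weak_submaj
     (map (\<lambda>(a, b). \<bar>a - b\<bar>)
        (zip (eigvals (mat_adjoint X * A * X)) (eigvals (mat_adjoint Y * A * Y))))
     (map (\<lambda>t. spr A * (1 - cos t + (sin t)\<^sup>2 / 2)) (principal_angles X Y))"
proof -
  have cG: "mat_adjoint X * Y \<in> carrier_mat k k" by (rule mult_carrier_mat[OF mat_adjoint_carrier[OF X(1)] Y(1)])
  obtain U V c where U: "U \<in> carrier_mat k k" "mat_adjoint U * U = 1\<^sub>m k"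
    and V: "V \<in> carrier_mat k k" "mat_adjoint V * V = 1\<^sub>m k"
    and G: "mat_adjoint X * Y = U * mat_diag k (\<lambda>i. complex_of_real (c i)) * mat_adjoint V"
    and c: "\<forall>i<k. 0 \<le> c i" "\<forall>i j. i \<le> j \<longrightarrow> j < k \<longrightarrow> c j \<le> c i"
    by (rule singular_value_decomposition[OF cG])
  let ?C = "mat_diag k (\<lambda>i. complex_of_real (c i))"
  have C: "?C \<in> carrier_mat k k" by simp
  have sv: "sing_vals (mat_adjoint X * Y) = map c [0..<k]" using c by (intro sing_vals_eq[OF U V G]) auto
  note aU = mat_adjoint_carrier[OF U(1)] and aV = mat_adjoint_carrier[OF V(1)]
    and aX = mat_adjoint_carrier[OF X(1)] and aY = mat_adjoint_carrier[OF Y(1)]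
  have XU: "X * U \<in> carrier_mat n k" and YV: "Y * V \<in> carrier_mat n k"
    using mult_carrier_mat[OF X(1) U(1)] mult_carrier_mat[OF Y(1) V(1)] .
  have cross: "mat_adjoint (P * Q) * (R * S) = mat_adjoint Q * (mat_adjoint P * R * S)"
    if P: "P \<in> carrier_mat n k" and Q: "Q \<in> carrier_mat k k" and R: "R \<in> carrier_mat n k" and S: "S \<in> carrier_mat k k"
    for P Q R S :: "complex mat"
    unfolding mat_adjoint_mult[OF P Q]
      assoc_mult_mat[OF mat_adjoint_carrier[OF Q] mat_adjoint_carrier[OF P] mult_carrier_mat[OF R S]]
      assoc_mult_mat[OF mat_adjoint_carrier[OF P] R S] ..
  have conj: "mat_adjoint (P * Q) * A * (P * Q) = mat_adjoint Q * (mat_adjoint P * A * P) * Q"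
    if P: "P \<in> carrier_mat n k" and Q: "Q \<in> carrier_mat k k" for P Q :: "complex mat"
  proof -
    note aP = mat_adjoint_carrier[OF P] and aQ = mat_adjoint_carrier[OF Q]
    have PA: "mat_adjoint P * A \<in> carrier_mat k n" by (rule mult_carrier_mat[OF aP A(1)])
    have "mat_adjoint (P * Q) * A * (P * Q) = mat_adjoint Q * (mat_adjoint P * A) * (P * Q)"
      unfolding mat_adjoint_mult[OF P Q] assoc_mult_mat[OF aQ aP A(1)] ..
    also have "\<dots> = mat_adjoint Q * (mat_adjoint P * A) * P * Q"
      by (rule assoc_mult_mat[symmetric, OF mult_carrier_mat[OF aQ PA] P Q])
    also have "mat_adjoint Q * (mat_adjoint P * A) * P = mat_adjoint Q * (mat_adjoint P * A * P)"
      by (rule assoc_mult_mat[OF aQ PA P])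
    finally show ?thesis .
  qed
  have XU1: "mat_adjoint (X * U) * (X * U) = 1\<^sub>m k" and YV1: "mat_adjoint (Y * V) * (Y * V) = 1\<^sub>m k"
    unfolding cross[OF X(1) U(1) X(1) U(1)] cross[OF Y(1) V(1) Y(1) V(1)] X(2) Y(2)
    using U V by (simp_all add: left_mult_one_mat[OF U(1)] left_mult_one_mat[OF V(1)])
  have UC: "U * ?C \<in> carrier_mat k k" by (rule mult_carrier_mat[OF U(1) C])
  have "mat_adjoint X * Y * V = U * ?C"
    unfolding G assoc_mult_mat[OF UC aV V(1)] V(2) by (rule right_mult_one_mat[OF UC])
  then have XUYV: "mat_adjoint (X * U) * (Y * V) = ?C"
    unfolding cross[OF X(1) U(1) Y(1) V(1)]
    using assoc_mult_mat[OF aU U(1) C] U(2) left_mult_one_mat[OF C] by simp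
  \<comment> \<open>\<open>U\<close> is unitary, so coordinates \<open>u\<close> with respect to
    \<open>X\<close> become \<open>mat_adjoint U *\<^sub>v u\<close> with respect to
    \<open>X U\<close>.\<close>
  have inv': "\<exists>u \<in> carrier_vec k. A *\<^sub>v ((X * U) *\<^sub>v w) = (X * U) *\<^sub>v u" if w: "w \<in> carrier_vec k" for w
  proof -
    have Uw: "U *\<^sub>v w \<in> carrier_vec k" by (rule mult_mat_vec_carrier[OF U(1) w])
    then have "X *\<^sub>v (U *\<^sub>v w) \<in> col_space X" using X(1) by (auto simp: col_space_def)
    then have "A *\<^sub>v (X *\<^sub>v (U *\<^sub>v w)) \<in> col_space X" using inv by (auto simp: invariant_subspace_def)
    then obtain u where u: "u \<in> carrier_vec k" "A *\<^sub>v (X *\<^sub>v (U *\<^sub>v w)) = X *\<^sub>v u"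
      using X(1) by (auto simp: col_space_def)
    have aUu: "mat_adjoint U *\<^sub>v u \<in> carrier_vec k" by (rule mult_mat_vec_carrier[OF aU u(1)])
    have "(X * U) *\<^sub>v (mat_adjoint U *\<^sub>v u) = X *\<^sub>v u"
      using assoc_mult_mat_vec[OF X(1) U(1) aUu] assoc_mult_mat_vec[OF U(1) aU u(1)] unitary_right[OF U] u(1) by simp
    then show ?thesis using u(2) aUu assoc_mult_mat_vec[OF X(1) U(1) w] by metis
  qed
  \<comment> \<open>\<open>spr\<close> reads the first and last entries of \<open>eigvals A\<close>,
    so the list must be nonempty; an isometry with a column cannot have zero rows.\<close>
  have n: "0 < n" if "0 < k"
  proof (rule ccontr)
    assume "\<not> 0 < n"
    then have "(mat_adjoint X * X) $$ (0, 0) = 0" using X(1) that by (simp add: scalar_prod_def)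
    then show False using X(2) that by simp
  qed
  let ?M = "mat_adjoint X * A * X" and ?N = "mat_adjoint Y * A * Y"
  note hM = hermitian_congruence[OF A X(1)] and hN = hermitian_congruence[OF A Y(1)]
  note eM = eigvals_unitary_conjugate[OF hM(1) U] and eN = eigvals_unitary_conjugate[OF hN(1) V]
  have len: "length (eigvals ?M) = k" "length (eigvals ?N) = k"
    using eigvals_diagonalization(2)[OF hM] eigvals_diagonalization(2)[OF hN] .
  define g where "g p = spr A * (1 - c p + (1 - (c p)\<^sup>2) / 2)" for p
  have bound: "(\<Sum>i\<in>I. \<bar>eigvals ?M ! i - eigvals ?N ! i\<bar>) \<le> (\<Sum>p\<in>{k - card I..<k}. g p)"
    if "I \<subseteq> {..<k}" "0 < k" for I
    using ritz_values_aligned(1)[OF A XU XU1 YV YV1 XUYV _ _ inv' that(1) n[OF that(2)]] c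
    unfolding conj[OF X(1) U(1)] conj[OF Y(1) V(1)] eM eN g_def by blast
  have c1: "c p \<le> 1" if "p < k" for p
    using ritz_values_aligned(2)[OF A XU XU1 YV YV1 XUYV _ _ inv' empty_subsetI, of p] n c that by auto
  have s0: "0 \<le> spr A" if "0 < k" using centered_contraction[OF A n[OF that]] by metis
  have gm: "g i \<le> g j" if "i \<le> j" "j < k" for i j
  proof -
    have "c j \<le> c i" "0 \<le> c j" using c that by auto
    moreover from this have "(c j)\<^sup>2 \<le> (c i)\<^sup>2" by (intro power_mono)
    ultimately have "1 - c i + (1 - (c i)\<^sup>2) / 2 \<le> 1 - c j + (1 - (c j)\<^sup>2) / 2" by argo
    then show ?thesis unfolding g_def using s0 that by (intro mult_left_mono) auto
  qed
  have angles: "map (\<lambda>t. spr A * (1 - cos t + (sin t)\<^sup>2 / 2)) (principal_angles X Y) = rev (map g [0..<k])"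
  proof -
    have "spr A * (1 - cos (arccos (c p)) + (sin (arccos (c p)))\<^sup>2 / 2) = g p" if "p < k" for p
    proof -
      \<comment> \<open>\<open>cos\<close> undoes \<open>arccos\<close> only on [-1, 1], which is
        where the upper bound on the cosines enters.\<close>
      have b: "-1 \<le> c p" "c p \<le> 1" using c(1) c1[OF that] that by (auto intro: order_trans[of _ 0])
      then have "(sin (arccos (c p)))\<^sup>2 = 1 - (c p)\<^sup>2" by (simp add: sin_squared_eq)
      then show ?thesis using b by (simp add: g_def)
    qed
    then show ?thesis by (simp add: principal_angles_def sing_vals_up_def sv rev_map)
  qed
  let ?x = "map (\<lambda>(a, b). \<bar>a - b\<bar>) (zip (eigvals ?M) (eigvals ?N))"
  have lx: "length ?x = k" using len by simp
  show ?thesis unfolding weak_submaj_def angles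
  proof (intro conjI ballI)
    show "length ?x = length (rev (map g [0..<k]))" using lx by simp
    fix j assume "j \<in> {1..length ?x}"
    then have j: "0 < k" "j \<le> k" using lx by auto
    obtain I where I: "I \<subseteq> {..<k}" "card I = j" "sum_list (take j (sort_desc ?x)) = (\<Sum>i\<in>I. ?x ! i)"
      using sum_list_take_sort_desc[of j ?x] j lx by auto
    have "(\<Sum>i\<in>I. ?x ! i) = (\<Sum>i\<in>I. \<bar>eigvals ?M ! i - eigvals ?N ! i\<bar>)"
      using I(1) len by (intro sum.cong) auto
    also have "\<dots> \<le> (\<Sum>p\<in>{k - j..<k}. g p)" using bound[OF I(1) j(1)] I(2) by simp
    also have "\<dots> = sum_list (take j (sort_desc (rev (map g [0..<k]))))"
      by (rule sum_list_take_sort_desc_rev[symmetric, OF gm j(2)])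
    finally show "sum_list (take j (sort_desc ?x)) \<le> sum_list (take j (sort_desc (rev (map g [0..<k]))))"
      unfolding I(3) .
  qed
qed

theorem theorem3p3:
  fixes A X Y :: "complex mat" and n k :: nat
  assumes "A \<in> carrier_mat n n" and "hermitian_mat A"
    and "X \<in> carrier_mat n k" and "Y \<in> carrier_mat n k"
    and "orthonormal_cols X" and "orthonormal_cols Y"
    and "invariant_subspace A (col_space X) \<or> invariant_subspace A (col_space Y)"
  shows "weak_submaj
     (map (\<lambda>(a, b). \<bar>a - b\<bar>)
        (zip (eigvals (mat_adjoint X * A * X)) (eigvals (mat_adjoint Y * A * Y))))
     (map (\<lambda>t. spr A * (1 - cos t + (sin t)\<^sup>2 / 2)) (principal_angles X Y))"
proof -
  have A: "A \<in> carrier_mat n n" "mat_adjoint A = A" using assms by (auto simp: hermitian_mat_def)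
  have X: "X \<in> carrier_mat n k" "mat_adjoint X * X = 1\<^sub>m k"
    and Y: "Y \<in> carrier_mat n k" "mat_adjoint Y * Y = 1\<^sub>m k"
    using assms by (auto simp: orthonormal_cols_def)
  from assms(7) show ?thesis
  proof
    assume "invariant_subspace A (col_space X)"
    then show ?thesis by (rule ritz_values_invariant[OF A X Y])
  next
    assume inv: "invariant_subspace A (col_space Y)"
    have "sing_vals (mat_adjoint (mat_adjoint X * Y)) = sing_vals (mat_adjoint X * Y)"
      by (rule sing_vals_adjoint[OF mult_carrier_mat[OF mat_adjoint_carrier[OF X(1)] Y(1)]])
    then have "principal_angles Y X = principal_angles X Y"
      using mat_adjoint_mult[OF mat_adjoint_carrier[OF X(1)] Y(1)]
      by (simp add: principal_angles_def sing_vals_up_def)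
    moreover have "map (\<lambda>(a, b). \<bar>a - b\<bar>) (zip xs ys) = map (\<lambda>(a, b). \<bar>a - b\<bar>) (zip ys xs)" for xs ys :: "real list"
      by (subst zip_commute) (auto simp: abs_minus_commute)
    ultimately show ?thesis using ritz_values_invariant[OF A Y X inv] by metis
  qed
qed

end
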